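(* Let $(\beta^1,\beta^2)\in\mathbb R^\tau\times\mathbb R^{\sigma-\tau}$. The following conclusions hold. (a) With respect to the canonical ensemble $\mathrm{Can}(H_n^1,H_n^2;P_n)_{a_n\beta^1,a_n\beta^2}$, $Y_n$ satisfies the LDP on $\mathcal X$ with rate function $$I_{\beta^1,\beta^2}(x):=I(x)+\langle\beta^1,\tilde H^1(x)\rangle+\langle\beta^2,\tilde H^2(x)\rangle-\inf_{y\in\mathcal X}\{I(y)+\langle\beta^1,\tilde H^1(y)\rangle+\langle\beta^2,\tilde H^2(y)\rangle\}.$$ (b) Let $u^2\in\operatorname{dom}J^2$. Both with respect to the mixed canonical-microcanonical ensemble $\mathrm{Can}(H_n^1;\mathrm{Micro}(H_n^2;P_n)^{u^2,r})_{a_n\beta^1}$ and with respect to the mixed microcanonical-canonical ensemble $\mathrm{Micro}(H_n^2;\mathrm{Can}(H_n^1;P_n)_{a_n\beta^1})^{u^2,r}$, $Y_n$ satisfies the LDP on $\mathcal X$, in the double limit $n\to\infty$ and $r\to0$, with rate function $$I_{\beta^1}^{u^2}(x):=I\big(\{x\}\cap(\tilde H^2)^{-1}(\{u^2\})\big)+\langle\beta^1,\tilde H^1(x)\rangle-\inf\{I(y)+\langle\beta^1,\tilde H^1(y)\rangle:y\in\mathcal X,\ \tilde H^2(y)=u^2\}.$$ (c) Let $u=(u^1,u^2)\in\operatorname{dom}J$. With respect to the microcanonical ensemble $\mathrm{Micro}(H_n^1,H_n^2;P_n)^{u^1,u^2,r}$, $Y_n$ satisfies the LDP on $\mathcal X$,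 in the double limit $n\to\infty$ and $r\to0$, with rate function $$I^{u^1,u^2}(x):=I\big(\{x\}\cap(\tilde H^1)^{-1}(\{u^1\})\cap(\tilde H^2)^{-1}(\{u^2\})\big)-J(u^1,u^2).$$
   Context: Setting. For each $n\in\mathbb N$, $(\Omega_n,\mathcal F_n,P_n)$ is a probability space; $\sigma\ge2$ is an integer; $H_{n,1},\dots,H_{n,\sigma}:\Omega_n\to\mathbb R$ are bounded measurable functions and $H_n:=(H_{n,1},\dots,H_{n,\sigma})$; $a_n>0$ are scaling constants with $a_n\to\infty$. $\mathcal X$ is a Polish space, $Y_n:\Omega_n\to\mathcal X$ are random variables, and $\tilde H_1,\dots,\tilde H_\sigma:\mathcal X\to\mathbb R$ are bounded continuous functions such that $\lim_{n\to\infty}\sup_{\omega\in\Omega_n}|H_{n,i}(\omega)-\tilde H_i(Y_n(\omega))|=0$ for each $i$; $\tilde H:=(\tilde H_1,\dots,\tilde H_\sigma)$. A rate function on $\mathcal X$ is a function $\mathcal X\to[0,\infty]$ with compact level sets $\{I\le M\}$, $0\le M<\infty$. The large deviation principle (LDP) is meant in the usual sense with scaling constants $a_n$. With respect to $P_n$, $Y_n$ satisfies the LDP on $\mathcal X$ with scaling constants $a_n$ and rate function $I$. For $A\subset\mathcal X$ and a rate function $K$, $K(A):=\inf_{x\in A}K(x)$, with $K(\emptyset)=\infty$. $\langle\cdot,\cdot\rangle$ denotes Euclidean inner products. Decomposition. $\tau$ is an integer with $1\le\tau\le\sigma$ (with $\mathbb R^0$ a single point if $\tau=\sigma$); $H_n^1:=(H_{n,1},\dots,H_{n,\tau})$,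 $H_n^2:=(H_{n,\tau+1},\dots,H_{n,\sigma})$, $\tilde H^1:=(\tilde H_1,\dots,\tilde H_\tau)$, $\tilde H^2:=(\tilde H_{\tau+1},\dots,\tilde H_\sigma)$. Ensembles. For $k\ge 1$, $v\in\mathbb R^k$, $r\in(0,1)$, $\{v\}^{(r)}:=[v_1-r,v_1+r]\times\cdots\times[v_k-r,v_k+r]$. For a probability measure $Q$ on $\Omega_n$ and a bounded measurable $G:\Omega_n\to\mathbb R^k$: $\mathrm{Can}(G;Q)_b$ is the probability measure proportional to $\exp[-\langle b,G(\omega)\rangle]\,Q(d\omega)$ ($b\in\mathbb R^k$), and $\mathrm{Micro}(G;Q)^{v,r}(d\omega):=Q(d\omega\mid G\in\{v\}^{(r)})$. Further $\mathrm{Can}(H_n^1,H_n^2;P_n)_{b^1,b^2}:=\mathrm{Can}(H_n;P_n)_{(b^1,b^2)}$ and $\mathrm{Micro}(H_n^1,H_n^2;P_n)^{u^1,u^2,r}:=\mathrm{Micro}(H_n;P_n)^{(u^1,u^2),r}$. $J(u^1,u^2):=\inf\{I(x):x\in\mathcal X,\tilde H^1(x)=u^1,\tilde H^2(x)=u^2\}$ and $J^2(u^2):=\inf\{I(x):x\in\mathcal X,\tilde H^2(x)=u^2\}$; $\operatorname{dom}J$ and $\operatorname{dom}J^2$ are the sets where these functions are finite. Under the stated conditions on $u^2$ and $(u^1,u^2)$ the conditioned ensembles are well defined for all sufficiently large $n$. LDP in the double limit: for probability measures $Q_{n,r}$ on $\Omega_n$, $Y_n$ satisfies the LDP with respect to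 $Q_{n,r}$ in the double limit $n\to\infty$, $r\to0$ with rate function $K$ if $\lim_{r\to0}\limsup_{n\to\infty}\frac1{a_n}\log Q_{n,r}\{Y_n\in F\}\le-K(F)$ for every closed $F\subset\mathcal X$ and $\lim_{r\to0}\liminf_{n\to\infty}\frac1{a_n}\log Q_{n,r}\{Y_n\in G\}\ge-K(G)$ for every open $G\subset\mathcal X$. *)

theory Defs
  imports "HOL-Probability.Probability_Measure"
begin

text \<open>
  The dimensions \<open>\<tau>\<close> and \<open>\<sigma> - \<tau>\<close> are term variables and the latter may be \<open>0\<close>, so a
  vector of \<open>\<real>\<^sup>k\<close> is a function \<open>v :: nat \<Rightarrow> real\<close> of which only the components \<open>v i\<close>,
  \<open>i \<in> {1..k}\<close>, are ever used; likewise a map into \<open>\<real>\<^sup>k\<close> is a family \<open>G\<close> of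
  real functions \<open>G i\<close>, \<open>i \<in> {1..k}\<close>.  For \<open>k = 0\<close> the index set is empty and
  \<open>\<real>\<^sup>0\<close> behaves as a single point.
\<close>

definition inner_prod :: "nat \<Rightarrow> (nat \<Rightarrow> real) \<Rightarrow> (nat \<Rightarrow> real) \<Rightarrow> real" where
  "inner_prod k v w = (\<Sum>i\<in>{1..k}. v i * w i)"

definition concat_vec :: "nat \<Rightarrow> (nat \<Rightarrow> real) \<Rightarrow> (nat \<Rightarrow> real) \<Rightarrow> nat \<Rightarrow> real" where
  "concat_vec \<tau> v w = (\<lambda>i. if i \<le> \<tau> then v i else w (i - \<tau>))"

text \<open>If \<open>G\<close> is a map into \<open>\<real>\<^sup>\<sigma>\<close>, its first block \<open>(G\<^sub>1, \<dots>, G\<^sub>\<tau>)\<close> is \<open>G\<close> itself read as a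
  map into \<open>\<real>\<^sup>\<tau>\<close>, and its second block, read as a map into \<open>\<real>\<close> to the power
  \<open>\<sigma> - \<tau>\<close>, is the following reindexing.\<close>

definition second_block :: "nat \<Rightarrow> (nat \<Rightarrow> 'a \<Rightarrow> real) \<Rightarrow> nat \<Rightarrow> 'a \<Rightarrow> real" where
  "second_block \<tau> G = (\<lambda>j. G (\<tau> + j))"

definition fiber :: "nat \<Rightarrow> (nat \<Rightarrow> 'a \<Rightarrow> real) \<Rightarrow> (nat \<Rightarrow> real) \<Rightarrow> 'a set" where
  "fiber k G v = {x. \<forall>i\<in>{1..k}. G i x = v i}"

definition canonical ::
  "nat \<Rightarrow> (nat \<Rightarrow> 'w \<Rightarrow> real) \<Rightarrow> (nat \<Rightarrow> real) \<Rightarrow> 'w measure \<Rightarrow> 'w measure" where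
  "canonical k G b Q =
     density Q (\<lambda>\<omega>. ennreal (exp (- inner_prod k b (\<lambda>i. G i \<omega>)) /
                             (\<integral>\<omega>'. exp (- inner_prod k b (\<lambda>i. G i \<omega>')) \<partial>Q)))"

text \<open>If the conditioning event is a null set, \<^const>\<open>uniform_measure\<close> does not yield a
  probability measure; \<open>LDP_double\<close> below demands probability measures for all large \<open>n\<close>.\<close>

definition microcanonical ::
  "nat \<Rightarrow> (nat \<Rightarrow> 'w \<Rightarrow> real) \<Rightarrow> (nat \<Rightarrow> real) \<Rightarrow> real \<Rightarrow> 'w measure \<Rightarrow> 'w measure" where
  "microcanonical k G v r Q =
     uniform_measure Q {\<omega> \<in> space Q. \<forall>i\<in>{1..k}. G i \<omega> \<in> {v i - r..v i + r}}"

definition rate_function :: "('x::topological_space \<Rightarrow> ereal) \<Rightarrow> bool" where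
  "rate_function K \<longleftrightarrow>
     (\<forall>x. 0 \<le> K x) \<and> (\<forall>M::real. 0 \<le> M \<longrightarrow> compact {x. K x \<le> ereal M})"

definition rate_of :: "('x \<Rightarrow> ereal) \<Rightarrow> 'x set \<Rightarrow> ereal" where
  "rate_of K A = (INF x\<in>A. K x)"

definition ln_prob :: "real \<Rightarrow> ereal" where
  "ln_prob p = (if p \<le> 0 then - \<infinity> else ereal (ln p))"

definition LDP ::
  "(nat \<Rightarrow> real) \<Rightarrow> (nat \<Rightarrow> 'w measure) \<Rightarrow> (nat \<Rightarrow> 'w \<Rightarrow> 'x::topological_space)
     \<Rightarrow> ('x \<Rightarrow> ereal) \<Rightarrow> bool" where
  "LDP a Q Y K \<longleftrightarrow>
     (\<forall>n. prob_space (Q n)) \<and> rate_function K \<and>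
     (\<forall>F. closed F \<longrightarrow>
        limsup (\<lambda>n. ereal (1 / a n) * ln_prob (measure (Q n) {\<omega> \<in> space (Q n). Y n \<omega> \<in> F}))
          \<le> - rate_of K F) \<and>
     (\<forall>G. open G \<longrightarrow>
        liminf (\<lambda>n. ereal (1 / a n) * ln_prob (measure (Q n) {\<omega> \<in> space (Q n). Y n \<omega> \<in> G}))
          \<ge> - rate_of K G)"

text \<open>The existence of the limits \<open>r \<rightarrow> 0\<close> is part of the definition.\<close>

definition LDP_double ::
  "(nat \<Rightarrow> real) \<Rightarrow> (nat \<Rightarrow> real \<Rightarrow> 'w measure) \<Rightarrow> (nat \<Rightarrow> 'w \<Rightarrow> 'x::topological_space)
     \<Rightarrow> ('x \<Rightarrow> ereal) \<Rightarrow> bool" where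
  "LDP_double a Q Y K \<longleftrightarrow>
     (\<forall>r\<in>{0<..<1}. \<forall>\<^sub>F n in sequentially. prob_space (Q n r)) \<and> rate_function K \<and>
     (\<forall>F. closed F \<longrightarrow>
        (\<exists>L. ((\<lambda>r. limsup (\<lambda>n. ereal (1 / a n) *
                 ln_prob (measure (Q n r) {\<omega> \<in> space (Q n r). Y n \<omega> \<in> F}))) \<longlongrightarrow> L) (at_right 0)
             \<and> L \<le> - rate_of K F)) \<and>
     (\<forall>G. open G \<longrightarrow>
        (\<exists>L. ((\<lambda>r. liminf (\<lambda>n. ereal (1 / a n) *
                 ln_prob (measure (Q n r) {\<omega> \<in> space (Q n r). Y n \<omega> \<in> G}))) \<longlongrightarrow> L) (at_right 0)
             \<and> L \<ge> - rate_of K G))"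

definition J_two ::
  "nat \<Rightarrow> nat \<Rightarrow> ('x \<Rightarrow> ereal) \<Rightarrow> (nat \<Rightarrow> 'x \<Rightarrow> real) \<Rightarrow> (nat \<Rightarrow> real) \<Rightarrow> ereal" where
  "J_two \<sigma> \<tau> I Ht u2 = (INF x\<in>fiber (\<sigma> - \<tau>) (second_block \<tau> Ht) u2. I x)"

definition J_joint ::
  "nat \<Rightarrow> nat \<Rightarrow> ('x \<Rightarrow> ereal) \<Rightarrow> (nat \<Rightarrow> 'x \<Rightarrow> real)
     \<Rightarrow> (nat \<Rightarrow> real) \<Rightarrow> (nat \<Rightarrow> real) \<Rightarrow> ereal" where
  "J_joint \<sigma> \<tau> I Ht u1 u2 =
     (INF x\<in>fiber \<tau> Ht u1 \<inter> fiber (\<sigma> - \<tau>) (second_block \<tau> Ht) u2. I x)"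

end

theory Submission
  imports Defs
begin

text \<open>All the ensembles are the measures \<open>P n\<close> reweighted by
  \<open>indicator {\<delta> n \<le> r} * exp (- a n * \<phi> n)\<close> and normalized, where \<open>\<phi> n\<close> is a linear
  combination of the Hamiltonians and \<open>\<delta> n\<close> is the supremum-norm distance of some of them from
  the prescribed values.  In particular tilting and conditioning commute, which is why the two
  mixed ensembles have the same rate function.  Both \<open>\<phi> n\<close> and \<open>\<delta> n\<close> are uniformly close to
  continuous functions \<open>\<psi>\<close> and \<open>d\<close> of \<open>Y n\<close>, so the unnormalized mass of \<open>Y n \<in> A\<close> is controlled by
  the large deviation principle of \<open>Y n\<close> alone.

  By Laplace's principle this mass decays at most with the rate \<open>I + \<psi>\<close> minimized over
  \<open>A \<inter> {d < r}\<close> when \<open>A\<close> is open (\<open>mass_lower\<close>), and at least with the rate \<open>I + \<psi>\<close> minimized over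
  \<open>A \<inter> {d \<le> r'}\<close>, for any \<open>r' > r\<close>, when \<open>A\<close> is closed (\<open>mass_upper\<close>).  As \<open>r\<close> tends to \<open>0\<close>,
  compactness of the level sets of \<open>I\<close> moves the second minimum to \<open>A \<inter> {d = 0}\<close>
  (\<open>fiber_gap\<close>), whereas the first is at most the minimum over that set for every \<open>r\<close>.

  Probabilities are quotients of such masses.  For the whole space both estimates give the same
  rate, the minimum of \<open>I + \<psi>\<close> on \<open>{d = 0}\<close>; it is subtracted from the rate of the numerator.
  The existence of the limit \<open>r \<rightarrow> 0\<close> is not automatic, as the quotient is not monotone in \<open>r\<close>:
  the growth rate of the numerator is monotone, that of the denominator converges to a finite
  number, and a sandwich argument (\<open>ratio_growth_tendsto\<close>) combines the two.

  The canonical ensemble is the case without constraint, where nothing depends on \<open>r\<close>, and the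
  microcanonical ensemble is the case without tilt.\<close>

section \<open>Probabilities on the logarithmic scale\<close>

text \<open>Large deviation bounds are handled below as inequalities \<open>p n \<le> exp (- a n * s)\<close> and
  \<open>exp (- a n * s) \<le> p n\<close> that hold eventually, for real \<open>s\<close>.  In this form products and finite
  sums of estimates are ordinary real arithmetic, and probabilities that vanish (logarithm
  \<open>-\<infinity>\<close>) are no special case.  The lemmas of this section translate to and from the
  formulation with \<open>limsup\<close> and \<open>liminf\<close>.\<close>

abbreviation scaled_log :: "real \<Rightarrow> real \<Rightarrow> ereal" where
  "scaled_log c p \<equiv> ereal (1 / c) * ln_prob p"

lemma scaled_log_le_iff:
  assumes "0 < c"
  shows "scaled_log c p \<le> ereal s \<longleftrightarrow> p \<le> exp (c * s)"
proof (cases "p \<le> 0")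
  case True
  then show ?thesis
    using assms by (auto simp: ln_prob_def intro: order_trans[of p 0 "exp (c * s)"])
next
  case False
  have "ln p / c \<le> s \<longleftrightarrow> ln p \<le> c * s"
    using assms by (simp add: divide_le_eq mult.commute)
  also have "\<dots> \<longleftrightarrow> p \<le> exp (c * s)"
    using False by (metis exp_le_cancel_iff exp_ln not_le)
  finally show ?thesis
    using False by (simp add: ln_prob_def)
qed

lemma less_scaled_log_iff:
  assumes "0 < c"
  shows "ereal s < scaled_log c p \<longleftrightarrow> exp (c * s) < p"
  using scaled_log_le_iff[OF assms, of p s] by (simp add: not_le [symmetric])

lemma scaled_log_mono:
  assumes "0 < c" "p \<le> q"
  shows "scaled_log c p \<le> scaled_log c q"
proof (rule ereal_le_real)
  fix z assume "scaled_log c q \<le> ereal z"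
  then show "scaled_log c p \<le> ereal z"
    using assms by (auto simp: scaled_log_le_iff)
qed

lemma scaled_log_divide:
  assumes "0 < c" "0 \<le> p" "0 < q"
  shows "scaled_log c (p / q) = scaled_log c p - scaled_log c q"
proof (cases "p = 0")
  case True
  then show ?thesis using assms by (simp add: ln_prob_def)
next
  case False
  then have "0 < p" using assms by simp
  then have "\<not> p / q \<le> 0" using assms by (simp add: not_le)
  then show ?thesis using \<open>0 < p\<close> assms
    by (simp add: ln_prob_def ln_div diff_divide_distrib not_le)
qed

lemma limsup_scaled_log_leI:
  assumes "\<And>n. 0 < a n"
    and "\<And>s. s < t \<Longrightarrow> \<forall>\<^sub>F n in sequentially. p n \<le> exp (- a n * s)"
  shows "limsup (\<lambda>n. scaled_log (a n) (p n)) \<le> - ereal t"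
proof (rule ereal_le_real)
  fix z assume "- ereal t \<le> ereal z"
  show "limsup (\<lambda>n. scaled_log (a n) (p n)) \<le> ereal z"
  proof (rule ereal_le_epsilon2)
    fix e :: real assume "0 < e"
    with \<open>- ereal t \<le> ereal z\<close> have "- (z + e) < t" by auto
    from assms(2)[OF this] have "\<forall>\<^sub>F n in sequentially. scaled_log (a n) (p n) \<le> ereal (z + e)"
      by eventually_elim (subst scaled_log_le_iff, use assms(1) in \<open>simp_all add: algebra_simps\<close>)
    then have "limsup (\<lambda>n. scaled_log (a n) (p n)) \<le> ereal (z + e)"
      by (rule Limsup_bounded)
    then show "limsup (\<lambda>n. scaled_log (a n) (p n)) \<le> ereal z + ereal e" by simp
  qed
qed

lemma limsup_scaled_log_lessD:
  assumes "\<And>n. 0 < a n" "limsup (\<lambda>n. scaled_log (a n) (p n)) < - ereal s"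
  shows "\<forall>\<^sub>F n in sequentially. p n \<le> exp (- a n * s)"
proof -
  have "\<forall>\<^sub>F n in sequentially. scaled_log (a n) (p n) < ereal (- s)"
    using Limsup_lessD[OF assms(2)] by simp
  then show ?thesis
  proof eventually_elim
    case (elim n)
    then have "scaled_log (a n) (p n) \<le> ereal (- s)" by simp
    then show ?case using assms(1) by (simp add: scaled_log_le_iff)
  qed
qed

lemma liminf_scaled_log_geI:
  assumes "\<And>n. 0 < a n"
    and "\<And>s. t < s \<Longrightarrow> \<forall>\<^sub>F n in sequentially. exp (- a n * s) \<le> p n"
  shows "- ereal t \<le> liminf (\<lambda>n. scaled_log (a n) (p n))"
proof (rule le_Liminf_iff[THEN iffD2], intro allI impI)
  fix y assume "y < - ereal t"
  then obtain q where q: "y < ereal q" "ereal q < - ereal t"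
    using ereal_dense2 by blast
  define s where "s = (- q + t) / 2"
  have "t < s" "- s > q" using q by (auto simp: s_def field_simps)
  show "\<forall>\<^sub>F n in sequentially. y < scaled_log (a n) (p n)"
    using assms(2)[OF \<open>t < s\<close>]
  proof eventually_elim
    case (elim n)
    have "exp (a n * q) < exp (- a n * s)"
      using assms(1)[of n] \<open>- s > q\<close> mult_strict_left_mono[of q "- s" "a n"] by simp
    with elim have "ereal q < scaled_log (a n) (p n)"
      using assms(1)[of n] by (simp add: less_scaled_log_iff del: exp_less_cancel_iff)
    with q show ?case by order
  qed
qed

lemma liminf_scaled_log_greaterD:
  assumes "\<And>n. 0 < a n" "- ereal s < liminf (\<lambda>n. scaled_log (a n) (p n))"
  shows "\<forall>\<^sub>F n in sequentially. exp (- a n * s) \<le> p n"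
proof -
  have "\<forall>\<^sub>F n in sequentially. ereal (- s) < scaled_log (a n) (p n)"
    using less_LiminfD[OF assms(2)] by simp
  then show ?thesis
    by eventually_elim (use assms(1) in \<open>simp add: less_scaled_log_iff\<close>)
qed

text \<open>The double limit asks for the limit \<open>r \<rightarrow> 0\<close> to exist.  Monotonicity is where this existence
  comes from: a smaller \<open>r\<close> is a stronger conditioning, hence a smaller unnormalized mass.\<close>

lemma mono_tendsto_at_right_INF:
  fixes f :: "real \<Rightarrow> ereal"
  assumes "\<And>r s. 0 < r \<Longrightarrow> r \<le> s \<Longrightarrow> f r \<le> f s"
  shows "(f \<longlongrightarrow> (INF r\<in>{0<..}. f r)) (at_right 0)"
proof (rule order_tendstoI)
  fix y assume "y < (INF r\<in>{0<..}. f r)"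
  then have "y < f r" if "0 < r" for r
    using that by (meson INF_lower greaterThan_iff less_le_trans)
  then show "\<forall>\<^sub>F r in at_right 0. y < f r"
    by (auto simp: eventually_at_right_field intro!: exI[of _ 1])
next
  fix y assume "(INF r\<in>{0<..}. f r) < y"
  then obtain s where "0 < s" "f s < y" by (auto simp: INF_less_iff)
  then show "\<forall>\<^sub>F r in at_right 0. f r < y"
    using assms by (auto simp: eventually_at_right_field intro!: exI[of _ s])
      (meson le_less_trans less_imp_le)
qed

text \<open>A sequence of measures without width parameter is a double sequence that is constant in \<open>r\<close>;
  limits of constants are unique because \<open>at_right 0\<close> is a nontrivial filter.\<close>

lemma LDP_if_LDP_double_const:
  assumes "LDP_double a (\<lambda>n r. Q n) Y K" "\<And>n. prob_space (Q n)"
  shows "LDP a Q Y K"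
proof -
  have nontrivial: "at_right (0::real) \<noteq> bot" by simp
  show ?thesis
    using assms unfolding LDP_def LDP_double_def
    by (auto simp: tendsto_const_iff[OF nontrivial])
qed

section \<open>Reweighting a probability measure\<close>

definition normalized :: "'w measure \<Rightarrow> ('w \<Rightarrow> real) \<Rightarrow> 'w measure" where
  "normalized P g = density P (\<lambda>\<omega>. ennreal (g \<omega> / (\<integral>\<omega>'. g \<omega>' \<partial>P)))"

lemma space_normalized [simp]: "space (normalized P g) = space P"
  and sets_normalized [simp, measurable_cong]: "sets (normalized P g) = sets P"
  by (simp_all add: normalized_def)

lemma normalized_cong:
  assumes "\<And>\<omega>. \<omega> \<in> space P \<Longrightarrow> f \<omega> = g \<omega>" "f \<in> borel_measurable P"
  shows "normalized P f = normalized P g"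
proof -
  have "(\<integral>\<omega>. f \<omega> \<partial>P) = (\<integral>\<omega>. g \<omega> \<partial>P)"
    using assms(1) by (intro Bochner_Integration.integral_cong) auto
  moreover have "g \<in> borel_measurable P"
    using assms measurable_cong[of P f g] by simp
  ultimately show ?thesis
    unfolding normalized_def using assms by (intro density_cong AE_I2) auto
qed

lemma integral_normalized:
  fixes f :: "'w \<Rightarrow> real"
  assumes "g \<in> borel_measurable P" "f \<in> borel_measurable P" "\<And>\<omega>. \<omega> \<in> space P \<Longrightarrow> 0 \<le> g \<omega>"
  shows "(\<integral>\<omega>. f \<omega> \<partial>normalized P g) = (\<integral>\<omega>. g \<omega> * f \<omega> \<partial>P) / (\<integral>\<omega>. g \<omega> \<partial>P)"
proof -
  have "0 \<le> (\<integral>\<omega>. g \<omega> \<partial>P)"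
    using assms by (intro integral_nonneg_AE) auto
  then have "(\<integral>\<omega>. f \<omega> \<partial>normalized P g) = (\<integral>\<omega>. (g \<omega> / (\<integral>\<omega>. g \<omega> \<partial>P)) *\<^sub>R f \<omega> \<partial>P)"
    unfolding normalized_def using assms by (intro integral_density) auto
  also have "\<dots> = (\<integral>\<omega>. (g \<omega> * f \<omega>) / (\<integral>\<omega>. g \<omega> \<partial>P) \<partial>P)"
    by (intro Bochner_Integration.integral_cong) auto
  finally show ?thesis by simp
qed

lemma prob_space_normalized:
  assumes "integrable P g" "\<And>\<omega>. \<omega> \<in> space P \<Longrightarrow> 0 \<le> g \<omega>" "0 < (\<integral>\<omega>. g \<omega> \<partial>P)"
  shows "prob_space (normalized P g)"
proof
  have "emeasure (normalized P g) (space P) = (\<integral>\<^sup>+\<omega>. ennreal (g \<omega> / (\<integral>\<omega>'. g \<omega>' \<partial>P)) \<partial>P)"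
    unfolding normalized_def using assms(1)
    by (subst emeasure_density) (auto intro!: nn_integral_cong simp: indicator_def)
  also have "\<dots> = ennreal (\<integral>\<omega>. g \<omega> / (\<integral>\<omega>'. g \<omega>' \<partial>P) \<partial>P)"
    using assms by (intro nn_integral_eq_integral) auto
  also have "\<dots> = 1" using assms(3) by simp
  finally show "emeasure (normalized P g) (space (normalized P g)) = 1" by simp
qed

lemma measure_normalized:
  assumes g: "integrable P g" "\<And>\<omega>. \<omega> \<in> space P \<Longrightarrow> 0 \<le> g \<omega>" "0 < (\<integral>\<omega>. g \<omega> \<partial>P)"
    and A: "A \<in> sets P"
  shows "measure (normalized P g) A = (\<integral>\<omega>. indicator A \<omega> * g \<omega> \<partial>P) / (\<integral>\<omega>. g \<omega> \<partial>P)"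
proof -
  interpret Q: prob_space "normalized P g"
    using prob_space_normalized[OF g] .
  have "measure (normalized P g) A = (\<integral>\<omega>. indicator A \<omega> \<partial>normalized P g)"
    using A sets.sets_into_space[OF A] by (simp add: Int_absorb2)
  also have "\<dots> = (\<integral>\<omega>. g \<omega> * indicator A \<omega> \<partial>P) / (\<integral>\<omega>. g \<omega> \<partial>P)"
    using g A by (intro integral_normalized) auto
  finally show ?thesis by (simp add: mult.commute)
qed

text \<open>Reweighting composes multiplicatively.  Since the product of weights commutes, tilting after
  conditioning and conditioning after tilting give one and the same measure.\<close>

lemma normalized_normalized:
  assumes f: "f \<in> borel_measurable P" "\<And>\<omega>. \<omega> \<in> space P \<Longrightarrow> 0 \<le> f \<omega>"
    and g: "g \<in> borel_measurable P" "\<And>\<omega>. \<omega> \<in> space P \<Longrightarrow> 0 \<le> g \<omega>"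
    and pos: "0 < (\<integral>\<omega>. f \<omega> \<partial>P)"
  shows "normalized (normalized P f) g = normalized P (\<lambda>\<omega>. f \<omega> * g \<omega>)"
proof -
  let ?Z = "\<integral>\<omega>. f \<omega> \<partial>P" and ?Z' = "\<integral>\<omega>. f \<omega> * g \<omega> \<partial>P"
  have nonneg: "0 \<le> ?Z'"
    using f g by (intro integral_nonneg_AE) auto
  have Z: "(\<integral>\<omega>. g \<omega> \<partial>normalized P f) = ?Z' / ?Z"
    using f g by (intro integral_normalized) auto
  have "normalized (normalized P f) g
      = density P (\<lambda>\<omega>. ennreal (f \<omega> / ?Z) * ennreal (g \<omega> / (?Z' / ?Z)))"
    unfolding normalized_def[of "normalized P f" g] Z
    unfolding normalized_def[of P f]
    using f g by (intro density_density_eq) auto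
  also have "\<dots> = normalized P (\<lambda>\<omega>. f \<omega> * g \<omega>)"
    unfolding normalized_def
  proof (intro density_cong AE_I2)
    fix \<omega> assume "\<omega> \<in> space P"
    then show "ennreal (f \<omega> / ?Z) * ennreal (g \<omega> / (?Z' / ?Z)) = ennreal (f \<omega> * g \<omega> / ?Z')"
      using f g pos nonneg by (subst ennreal_mult[symmetric]) auto
  qed (use f g in auto)
  finally show ?thesis .
qed

lemma uniform_measure_eq_normalized:
  assumes "prob_space P" "C \<in> sets P" "0 < measure P C"
  shows "uniform_measure P C = normalized P (indicator C)"
proof -
  interpret prob_space P by fact
  have "(\<integral>\<omega>. indicator C \<omega> \<partial>P) = measure P C"
    using assms sets.sets_into_space[of C P] by (simp add: Int_absorb2)
  then show ?thesis
    unfolding uniform_measure_def normalized_def using assms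
    by (intro density_cong AE_I2)
      (auto simp: indicator_def emeasure_eq_measure divide_ennreal simp flip: ennreal_1)
qed

section \<open>Sequences satisfying a large deviation principle\<close>

locale ldp_sequence =
  fixes P :: "nat \<Rightarrow> 'w measure" and a :: "nat \<Rightarrow> real"
    and Y :: "nat \<Rightarrow> 'w \<Rightarrow> 'x::t2_space" and I :: "'x \<Rightarrow> ereal"
  assumes prob_P: "\<And>n. prob_space (P n)"
    and a_pos: "\<And>n. 0 < a n"
    and a_lim: "filterlim a at_top sequentially"
    and Y_measurable [measurable]: "\<And>n. Y n \<in> measurable (P n) borel"
    and LDP_P: "LDP a P Y I"
begin

lemma I_nonneg: "0 \<le> I x"
  using LDP_P by (simp add: LDP_def rate_function_def)

lemma compact_level: "compact {x. I x \<le> ereal c}"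
proof (cases "0 \<le> c")
  case True
  then show ?thesis using LDP_P by (simp add: LDP_def rate_function_def)
next
  case False
  then have "{x. I x \<le> ereal c} = {}"
    using I_nonneg order_trans[of 0 "I _" "ereal c"] by auto
  then show ?thesis by simp
qed

lemma prob_closed_le:
  assumes "closed F" "\<And>x. x \<in> F \<Longrightarrow> ereal t \<le> I x" "s < t"
  shows "\<forall>\<^sub>F n in sequentially. measure (P n) {\<omega> \<in> space (P n). Y n \<omega> \<in> F} \<le> exp (- a n * s)"
proof (rule limsup_scaled_log_lessD[OF a_pos])
  have "ereal t \<le> rate_of I F"
    unfolding rate_of_def using assms(2) by (intro INF_greatest)
  then have "- rate_of I F \<le> - ereal t" by (simp only: ereal_minus_le_minus)
  also have "\<dots> < - ereal s" using assms(3) by simp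
  finally have "- rate_of I F < - ereal s" .
  moreover have "limsup (\<lambda>n. scaled_log (a n) (measure (P n) {\<omega> \<in> space (P n). Y n \<omega> \<in> F}))
      \<le> - rate_of I F"
    using LDP_P assms(1) by (auto simp: LDP_def)
  ultimately show "limsup (\<lambda>n. scaled_log (a n) (measure (P n) {\<omega> \<in> space (P n). Y n \<omega> \<in> F}))
      < - ereal s" by order
qed

lemma prob_open_ge:
  assumes "open G" "x \<in> G" "I x < ereal s"
  shows "\<forall>\<^sub>F n in sequentially. exp (- a n * s) \<le> measure (P n) {\<omega> \<in> space (P n). Y n \<omega> \<in> G}"
proof (rule liminf_scaled_log_greaterD[OF a_pos])
  have "rate_of I G \<le> I x"
    unfolding rate_of_def using assms(2) by (intro INF_lower)
  with assms(3) have "rate_of I G < ereal s" by order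
  then have "- ereal s < - rate_of I G" by (simp only: ereal_minus_less_minus)
  moreover have "- rate_of I G \<le> 
      liminf (\<lambda>n. scaled_log (a n) (measure (P n) {\<omega> \<in> space (P n). Y n \<omega> \<in> G}))"
    using LDP_P assms(1) by (auto simp: LDP_def)
  ultimately show "- ereal s < 
      liminf (\<lambda>n. scaled_log (a n) (measure (P n) {\<omega> \<in> space (P n). Y n \<omega> \<in> G}))" by order
qed

text \<open>If the rate were infinite everywhere, the upper bound for the whole space would make the
  total mass \<open>1\<close> exponentially small.\<close>

lemma ex_finite_rate: "\<exists>x. I x < \<infinity>"
proof (rule ccontr)
  assume "\<not> ?thesis"
  then have "\<forall>\<^sub>F n in sequentially. measure (P n) {\<omega> \<in> space (P n). Y n \<omega> \<in> UNIV} \<le> exp (- a n * 1)"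
    by (intro prob_closed_le[where t = 2]) (auto simp: not_less)
  from eventually_happens'[OF sequentially_bot this]
  obtain n where "measure (P n) {\<omega> \<in> space (P n). Y n \<omega> \<in> UNIV} \<le> exp (- a n * 1)" ..
  moreover have "exp (- a n * 1) < 1" using a_pos[of n] by simp
  ultimately show False using prob_space.prob_space[OF prob_P[of n]] by simp
qed

definition approximates :: "(nat \<Rightarrow> 'w \<Rightarrow> real) \<Rightarrow> ('x \<Rightarrow> real) \<Rightarrow> bool" where
  "approximates g h \<longleftrightarrow>
     (\<forall>\<epsilon>>0. \<forall>\<^sub>F n in sequentially. \<forall>\<omega>\<in>space (P n). \<bar>g n \<omega> - h (Y n \<omega>)\<bar> \<le> \<epsilon>)"

lemma approximatesD:
  "approximates g h \<Longrightarrow> 0 < \<epsilon> \<Longrightarrow>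
     \<forall>\<^sub>F n in sequentially. \<forall>\<omega>\<in>space (P n). \<bar>g n \<omega> - h (Y n \<omega>)\<bar> \<le> \<epsilon>"
  by (simp add: approximates_def)

end

section \<open>Exponential asymptotics of tilted and conditioned masses\<close>

text \<open>All ensembles are instances of one situation: \<open>P n\<close> is tilted by \<open>exp (- a n * \<phi> n)\<close>
  and conditioned on \<open>\<delta> n \<le> r\<close>, where \<open>\<phi> n\<close> and \<open>\<delta> n\<close> are uniformly close to functions
  \<open>\<psi>\<close> and \<open>d\<close> of \<open>Y n\<close>.  The function \<open>d\<close> measures the distance from the constraint, so
  that the constraint set is \<open>{x. d x = 0}\<close>.\<close>

locale tilted_conditioned = ldp_sequence P a Y I
  for P :: "nat \<Rightarrow> 'w measure" and a :: "nat \<Rightarrow> real"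
    and Y :: "nat \<Rightarrow> 'w \<Rightarrow> 'x::t2_space" and I :: "'x \<Rightarrow> ereal" +
  fixes \<phi> :: "nat \<Rightarrow> 'w \<Rightarrow> real" and \<psi> :: "'x \<Rightarrow> real"
    and \<delta> :: "nat \<Rightarrow> 'w \<Rightarrow> real" and d :: "'x \<Rightarrow> real"
  assumes \<phi>_measurable [measurable]: "\<And>n. \<phi> n \<in> borel_measurable (P n)"
    and \<phi>_bounded: "\<And>n. bounded (\<phi> n ` space (P n))"
    and \<psi>_continuous: "continuous_on UNIV \<psi>"
    and \<psi>_bounded: "bounded (range \<psi>)"
    and \<phi>_approx: "approximates \<phi> \<psi>"
    and \<delta>_measurable [measurable]: "\<And>n. \<delta> n \<in> borel_measurable (P n)"
    and d_continuous: "continuous_on UNIV d"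
    and d_nonneg: "\<And>x. 0 \<le> d x"
    and \<delta>_approx: "approximates \<delta> d"
    and fiber_finite: "\<exists>x. d x = 0 \<and> I x < \<infinity>"
begin

definition weight :: "nat \<Rightarrow> real \<Rightarrow> 'w \<Rightarrow> real" where
  "weight n r \<omega> = indicator {\<omega> \<in> space (P n). \<delta> n \<omega> \<le> r} \<omega> * exp (- a n * \<phi> n \<omega>)"

definition mass :: "nat \<Rightarrow> real \<Rightarrow> 'x set \<Rightarrow> real" where
  "mass n r A = (\<integral>\<omega>. indicator {\<omega> \<in> space (P n). Y n \<omega> \<in> A} \<omega> * weight n r \<omega> \<partial>P n)"

lemma weight_measurable [measurable]: "weight n r \<in> borel_measurable (P n)"
  unfolding weight_def by measurable

lemma weight_nonneg: "0 \<le> weight n r \<omega>"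
  by (simp add: weight_def)

lemma weight_bounded:
  obtains B where "\<And>\<omega>. \<omega> \<in> space (P n) \<Longrightarrow> weight n r \<omega> \<le> B"
proof -
  obtain b where b: "\<And>\<omega>. \<omega> \<in> space (P n) \<Longrightarrow> \<bar>\<phi> n \<omega>\<bar> \<le> b"
    using \<phi>_bounded[of n] by (auto simp: bounded_iff)
  show thesis
  proof (rule that)
    fix \<omega> assume "\<omega> \<in> space (P n)"
    with b have "- \<phi> n \<omega> \<le> b" by force
    then have "- a n * \<phi> n \<omega> \<le> a n * b"
      using mult_left_mono[of "- \<phi> n \<omega>" b "a n"] a_pos[of n] by simp
    then show "weight n r \<omega> \<le> exp (a n * b)"
      by (auto simp: weight_def indicator_def)
  qed
qed

lemma integrable_indicator_weight [simp]:
  assumes [measurable]: "A \<in> sets (P n)"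
  shows "integrable (P n) (\<lambda>\<omega>. indicator A \<omega> * weight n r \<omega>)"
proof -
  interpret prob_space "P n" by (rule prob_P)
  obtain B where B: "\<And>\<omega>. \<omega> \<in> space (P n) \<Longrightarrow> weight n r \<omega> \<le> B"
    using weight_bounded by blast
  show ?thesis
  proof (rule integrable_const_bound[where B = "max 0 B"])
    show "AE \<omega> in P n. norm (indicator A \<omega> * weight n r \<omega>) \<le> max 0 B"
      using B weight_nonneg by (intro AE_I2) (auto simp: indicator_def max.coboundedI2)
  qed measurable
qed

lemma integrable_weight: "integrable (P n) (weight n r)"
proof -
  have "integrable (P n) (\<lambda>\<omega>. indicator (space (P n)) \<omega> * weight n r \<omega>)" by simp
  moreover have "integrable (P n) (\<lambda>\<omega>. indicator (space (P n)) \<omega> * weight n r \<omega>) \<longleftrightarrow> integrable (P n) (weight n r)"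
    by (intro Bochner_Integration.integrable_cong) auto
  ultimately show ?thesis by simp
qed

lemma event_measurable [measurable]:
  assumes [measurable]: "A \<in> sets borel"
  shows "{\<omega> \<in> space (P n). Y n \<omega> \<in> A} \<in> sets (P n)"
  by measurable

lemma mass_nonneg: "0 \<le> mass n r A"
  unfolding mass_def by (intro integral_nonneg_AE AE_I2) (simp add: weight_nonneg)

lemma mass_UNIV: "mass n r UNIV = (\<integral>\<omega>. weight n r \<omega> \<partial>P n)"
  unfolding mass_def by (intro Bochner_Integration.integral_cong) auto

lemma mass_mono:
  assumes "r \<le> s" "A \<in> sets borel"
  shows "mass n r A \<le> mass n s A"
  unfolding mass_def
proof (intro integral_mono integrable_indicator_weight event_measurable assms(2))
  fix \<omega>
  have "weight n r \<omega> \<le> weight n s \<omega>"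
    using assms(1) by (auto simp: weight_def indicator_def)
  then show "indicator {\<omega> \<in> space (P n). Y n \<omega> \<in> A} \<omega> * weight n r \<omega>
      \<le> indicator {\<omega> \<in> space (P n). Y n \<omega> \<in> A} \<omega> * weight n s \<omega>"
    by (intro mult_left_mono) auto
qed

text \<open>Laplace's principle.  The range of \<open>\<psi>\<close> is cut into finitely many slabs of height \<open>\<epsilon>\<close>.  On
  a slab \<open>c j \<le> \<psi> \<le> c j + \<epsilon>\<close> the weight is about \<open>exp (- a n * c j)\<close>, and there \<open>t \<le> I + \<psi>\<close>
  forces \<open>I \<ge> t - c j - \<epsilon>\<close>, so by the upper bound for closed sets the slab contributes about
  \<open>exp (- a n * t)\<close>.  The number of slabs does not depend on \<open>n\<close> and disappears on the
  exponential scale.  The gap between \<open>r\<close> and \<open>r'\<close> absorbs the difference between \<open>\<delta> n\<close> and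
  \<open>d (Y n)\<close>.\<close>

lemma mass_upper:
  assumes "closed F" "r < r'" and F: "\<And>x. x \<in> F \<Longrightarrow> d x \<le> r' \<Longrightarrow> ereal t \<le> I x + ereal (\<psi> x)"
    and "s < t"
  shows "\<forall>\<^sub>F n in sequentially. mass n r F \<le> exp (- a n * s)"
proof -
  \<comment> \<open>One \<open>\<epsilon>\<close> each is lost to the slab height, to the strictness of the bound for closed sets,
      to replacing \<open>\<phi> n\<close> by \<open>\<psi>\<close>, and to the number of slabs.\<close>
  define \<epsilon> where "\<epsilon> = (t - s) / 4"
  have "0 < \<epsilon>" using \<open>s < t\<close> by (simp add: \<epsilon>_def)
  obtain B where B: "\<And>x. \<bar>\<psi> x\<bar> \<le> B" using \<psi>_bounded by (auto simp: bounded_iff)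
  define c where "c j = - B + real j * \<epsilon>" for j :: nat
  define N where "N = Suc (nat \<lceil>2 * B / \<epsilon>\<rceil>)"
  define S where "S j = F \<inter> {x. d x \<le> r'} \<inter> {x. c j \<le> \<psi> x} \<inter> {x. \<psi> x \<le> c j + \<epsilon>}" for j
  define E where "E n j = {\<omega> \<in> space (P n). Y n \<omega> \<in> S j}" for n j
  have closed_S: "closed (S j)" for j
    unfolding S_def
    by (intro closed_Int \<open>closed F\<close> closed_Collect_le continuous_on_const d_continuous \<psi>_continuous)
  have [measurable]: "E n j \<in> sets (P n)" for n j
    unfolding E_def using closed_S by (intro event_measurable borel_closed)
  have cover: "\<exists>j<N. c j \<le> \<psi> x \<and> \<psi> x \<le> c j + \<epsilon>" for x
  proof (intro exI[of _ "nat \<lfloor>(\<psi> x + B) / \<epsilon>\<rfloor>"] conjI)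
    let ?q = "(\<psi> x + B) / \<epsilon>"
    have q: "0 \<le> ?q" "?q \<le> 2 * B / \<epsilon>"
      using B[of x] \<open>0 < \<epsilon>\<close> by (auto intro!: divide_right_mono simp: abs_le_iff)
    then have "\<lfloor>?q\<rfloor> \<le> \<lceil>2 * B / \<epsilon>\<rceil>" by linarith
    with q show "nat \<lfloor>?q\<rfloor> < N" by (simp add: N_def nat_mono less_Suc_eq_le)
    have "real (nat \<lfloor>?q\<rfloor>) \<le> ?q" "?q \<le> real (nat \<lfloor>?q\<rfloor>) + 1" using q by linarith+
    then show "c (nat \<lfloor>?q\<rfloor>) \<le> \<psi> x" "\<psi> x \<le> c (nat \<lfloor>?q\<rfloor>) + \<epsilon>"
      using \<open>0 < \<epsilon>\<close> by (auto simp: c_def field_simps)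
  qed
  have slab: "\<forall>\<^sub>F n in sequentially. measure (P n) (E n j) \<le> exp (- a n * (t - c j - 2 * \<epsilon>))" for j
    unfolding E_def
  proof (rule prob_closed_le[OF closed_S])
    fix x assume "x \<in> S j"
    with F[of x] show "ereal (t - c j - \<epsilon>) \<le> I x"
      by (cases "I x") (auto simp: S_def)
  qed (use \<open>0 < \<epsilon>\<close> in simp)
  have "\<forall>\<^sub>F n in sequentially. \<forall>j\<in>{..<N}. measure (P n) (E n j) \<le> exp (- a n * (t - c j - 2 * \<epsilon>))"
    using slab by (intro eventually_ball_finite) auto
  moreover have "\<forall>\<^sub>F n in sequentially. \<forall>\<omega>\<in>space (P n). \<bar>\<phi> n \<omega> - \<psi> (Y n \<omega>)\<bar> \<le> \<epsilon>"
    using approximatesD[OF \<phi>_approx \<open>0 < \<epsilon>\<close>] .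
  moreover have "\<forall>\<^sub>F n in sequentially. \<forall>\<omega>\<in>space (P n). \<bar>\<delta> n \<omega> - d (Y n \<omega>)\<bar> \<le> r' - r"
    using approximatesD[OF \<delta>_approx] \<open>r < r'\<close> by simp
  moreover have "\<forall>\<^sub>F n in sequentially. ln (real N) / \<epsilon> \<le> a n"
    using a_lim by (simp add: filterlim_at_top)
  ultimately show ?thesis
  proof eventually_elim
    case (elim n)
    interpret prob_space "P n" by (rule prob_P)
    have "mass n r F \<le> (\<integral>\<omega>. (\<Sum>j<N. exp (- a n * (c j - \<epsilon>)) * indicator (E n j) \<omega>) \<partial>P n)"
      unfolding mass_def
    proof (rule integral_mono)
      fix \<omega> assume \<omega>: "\<omega> \<in> space (P n)"
      let ?f = "\<lambda>j. exp (- a n * (c j - \<epsilon>)) * indicator (E n j) \<omega>"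
      have nonneg: "0 \<le> ?f j" for j by simp
      show "indicator {\<omega> \<in> space (P n). Y n \<omega> \<in> F} \<omega> * weight n r \<omega> \<le> (\<Sum>j<N. ?f j)"
      proof (cases "Y n \<omega> \<in> F \<and> \<delta> n \<omega> \<le> r")
        case True
        obtain j where j: "j < N" "c j \<le> \<psi> (Y n \<omega>)" "\<psi> (Y n \<omega>) \<le> c j + \<epsilon>" using cover by blast
        have "d (Y n \<omega>) \<le> r'" using elim(3) \<omega> True by force
        with j True \<omega> have "\<omega> \<in> E n j" by (auto simp: E_def S_def)
        have "c j - \<epsilon> \<le> \<phi> n \<omega>" using elim(2) \<omega> j by force
        then have "exp (- a n * \<phi> n \<omega>) \<le> ?f j"
          using a_pos[of n] \<open>\<omega> \<in> E n j\<close> by simp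
        also have "\<dots> \<le> (\<Sum>j<N. ?f j)"
          using j nonneg by (intro member_le_sum) auto
        finally show ?thesis using True \<omega> by (simp add: weight_def)
      next
        case False
        then show ?thesis using sum_nonneg[of "{..<N}" ?f] nonneg
          by (auto simp: weight_def indicator_def)
      qed
    next
      show "integrable (P n) (\<lambda>\<omega>. indicator {\<omega> \<in> space (P n). Y n \<omega> \<in> F} \<omega> * weight n r \<omega>)"
        using \<open>closed F\<close> by (intro integrable_indicator_weight event_measurable borel_closed)
    next
      show "integrable (P n) (\<lambda>\<omega>. \<Sum>j<N. exp (- a n * (c j - \<epsilon>)) * indicator (E n j) \<omega>)"
        by (intro Bochner_Integration.integrable_sum integrable_mult_right integrable_real_indicator)
          (auto simp: emeasure_eq_measure)
    qed
    also have "\<dots> = (\<Sum>j<N. exp (- a n * (c j - \<epsilon>)) * measure (P n) (E n j))"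
      by (subst Bochner_Integration.integral_sum)
        (auto intro!: integrable_mult_right integrable_real_indicator simp: emeasure_eq_measure)
    also have "\<dots> \<le> (\<Sum>j<N. exp (- a n * (c j - \<epsilon>)) * exp (- a n * (t - c j - 2 * \<epsilon>)))"
      using elim(1) by (intro sum_mono mult_left_mono) auto
    also have "\<dots> = real N * exp (- a n * (t - 3 * \<epsilon>))"
      by (simp add: algebra_simps flip: exp_add)
    also have "\<dots> \<le> exp (a n * \<epsilon>) * exp (- a n * (t - 3 * \<epsilon>))"
    proof (rule mult_right_mono)
      have "ln (real N) \<le> a n * \<epsilon>" using elim(4) \<open>0 < \<epsilon>\<close> by (simp add: divide_le_eq)
      moreover have "0 < real N" by (simp add: N_def)
      ultimately show "real N \<le> exp (a n * \<epsilon>)" by (metis exp_le_cancel_iff exp_ln)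
    qed simp
    also have "\<dots> = exp (- a n * s)"
      unfolding exp_add [symmetric] \<epsilon>_def by (simp add: field_simps)
    finally show ?case .
  qed
qed

text \<open>Near \<open>x\<close> the tilting function stays close to \<open>\<psi> x\<close> and \<open>d < r\<close>, so the mass of a small open
  neighbourhood is about \<open>exp (- a n * \<psi> x)\<close> times its probability.\<close>

lemma mass_lower:
  assumes "open G" "x \<in> G" "d x < r" "I x + ereal (\<psi> x) < ereal t"
  shows "\<forall>\<^sub>F n in sequentially. exp (- a n * t) \<le> mass n r G"
proof -
  obtain i where i: "I x = ereal i"
    using assms(4) I_nonneg[of x] by (cases "I x") auto
  define \<epsilon> where "\<epsilon> = min ((t - i - \<psi> x) / 3) (r - d x)"
  have \<epsilon>: "0 < \<epsilon>" "i + \<psi> x + 3 * \<epsilon> \<le> t" "d x + \<epsilon> \<le> r"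
    using assms(3,4) by (auto simp: \<epsilon>_def i min_def field_simps)
  \<comment> \<open>Half of the room between \<open>d x\<close> and \<open>r\<close> is spent on the neighbourhood of \<open>x\<close>, half on
      replacing \<open>d\<close> by \<open>\<delta> n\<close>.\<close>
  define \<eta> where "\<eta> = \<epsilon> / 2"
  have \<eta>: "0 < \<eta>" "\<eta> + \<eta> = \<epsilon>" using \<epsilon> by (auto simp: \<eta>_def)
  define U where "U = G \<inter> {y. d y < d x + \<eta>} \<inter> {y. \<psi> y < \<psi> x + \<epsilon>}"
  define E where "E n = {\<omega> \<in> space (P n). Y n \<omega> \<in> U}" for n
  have "open U"
    unfolding U_def
    by (intro open_Int \<open>open G\<close> open_Collect_less continuous_on_const d_continuous \<psi>_continuous)
  then have [measurable]: "E n \<in> sets (P n)" for n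
    unfolding E_def by (intro event_measurable borel_open)
  have "\<forall>\<^sub>F n in sequentially. exp (- a n * (i + \<epsilon>)) \<le> measure (P n) (E n)"
    unfolding E_def
    by (rule prob_open_ge[OF \<open>open U\<close>, of x]) (use assms \<epsilon> \<eta> i in \<open>auto simp: U_def\<close>)
  moreover have "\<forall>\<^sub>F n in sequentially. \<forall>\<omega>\<in>space (P n). \<bar>\<phi> n \<omega> - \<psi> (Y n \<omega>)\<bar> \<le> \<epsilon>"
    using approximatesD[OF \<phi>_approx \<epsilon>(1)] .
  moreover have "\<forall>\<^sub>F n in sequentially. \<forall>\<omega>\<in>space (P n). \<bar>\<delta> n \<omega> - d (Y n \<omega>)\<bar> \<le> \<eta>"
    using approximatesD[OF \<delta>_approx \<eta>(1)] .
  ultimately show ?thesis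
  proof eventually_elim
    case (elim n)
    interpret prob_space "P n" by (rule prob_P)
    have "exp (- a n * t) \<le> exp (- a n * (\<psi> x + 2 * \<epsilon>)) * exp (- a n * (i + \<epsilon>))"
      using \<epsilon>(2) mult_left_mono[of "i + \<psi> x + 3 * \<epsilon>" t "a n"] a_pos[of n]
      unfolding exp_add [symmetric] by (simp add: algebra_simps)
    also have "\<dots> \<le> exp (- a n * (\<psi> x + 2 * \<epsilon>)) * measure (P n) (E n)"
      using elim(1) by (intro mult_left_mono) auto
    also have "\<dots> = (\<integral>\<omega>. exp (- a n * (\<psi> x + 2 * \<epsilon>)) * indicator (E n) \<omega> \<partial>P n)"
      by simp
    also have "\<dots> \<le> mass n r G"
      unfolding mass_def
    proof (rule integral_mono)
      fix \<omega> assume \<omega>: "\<omega> \<in> space (P n)"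
      show "exp (- a n * (\<psi> x + 2 * \<epsilon>)) * indicator (E n) \<omega>
          \<le> indicator {\<omega> \<in> space (P n). Y n \<omega> \<in> G} \<omega> * weight n r \<omega>"
      proof (cases "\<omega> \<in> E n")
        case True
        then have U: "Y n \<omega> \<in> G" "d (Y n \<omega>) < d x + \<eta>" "\<psi> (Y n \<omega>) < \<psi> x + \<epsilon>"
          by (auto simp: E_def U_def)
        have "\<delta> n \<omega> - d (Y n \<omega>) \<le> \<eta>" using elim(3) \<omega> by force
        then have "\<delta> n \<omega> \<le> r" using U \<epsilon> \<eta> by linarith
        have "\<phi> n \<omega> - \<psi> (Y n \<omega>) \<le> \<epsilon>" using elim(2) \<omega> by force
        then have "\<phi> n \<omega> \<le> \<psi> x + 2 * \<epsilon>" using U by linarith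
        then show ?thesis
          using True U \<omega> a_pos[of n] \<open>\<delta> n \<omega> \<le> r\<close> by (simp add: weight_def)
      next
        case False
        then show ?thesis by (simp add: weight_nonneg)
      qed
    next
      show "integrable (P n) (\<lambda>\<omega>. indicator {\<omega> \<in> space (P n). Y n \<omega> \<in> G} \<omega> * weight n r \<omega>)"
        using \<open>open G\<close> by (intro integrable_indicator_weight event_measurable borel_open)
    next
      show "integrable (P n) (\<lambda>\<omega>. exp (- a n * (\<psi> x + 2 * \<epsilon>)) * indicator (E n) \<omega>)"
        by (intro integrable_mult_right integrable_real_indicator) (auto simp: emeasure_eq_measure)
    qed
    finally show ?case .
  qed
qed

section \<open>The limit of vanishing width\<close>

definition log_mass :: "nat \<Rightarrow> real \<Rightarrow> 'x set \<Rightarrow> ereal" where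
  "log_mass n r A = scaled_log (a n) (mass n r A)"

definition upper_growth :: "real \<Rightarrow> 'x set \<Rightarrow> ereal" where
  "upper_growth r A = limsup (\<lambda>n. log_mass n r A)"

definition lower_growth :: "real \<Rightarrow> 'x set \<Rightarrow> ereal" where
  "lower_growth r A = liminf (\<lambda>n. log_mass n r A)"

lemma upper_growth_le:
  assumes "closed F" "r < r'" "\<And>x. x \<in> F \<Longrightarrow> d x \<le> r' \<Longrightarrow> ereal t \<le> I x + ereal (\<psi> x)"
  shows "upper_growth r F \<le> - ereal t"
  unfolding upper_growth_def log_mass_def
  using assms by (intro limsup_scaled_log_leI a_pos mass_upper)

lemma lower_growth_ge:
  assumes "open G" "x \<in> G" "d x < r"
  shows "- (I x + ereal (\<psi> x)) \<le> lower_growth r G"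
proof (cases "I x")
  case (real i)
  have "- ereal (i + \<psi> x) \<le> lower_growth r G"
    unfolding lower_growth_def log_mass_def
    using assms real by (intro liminf_scaled_log_geI a_pos mass_lower[of G x]) auto
  with real show ?thesis by simp
qed (use I_nonneg[of x] in auto)

lemma log_mass_mono:
  assumes "r \<le> s" "A \<in> sets borel"
  shows "log_mass n r A \<le> log_mass n s A"
  unfolding log_mass_def using assms a_pos by (intro scaled_log_mono mass_mono)

lemma upper_growth_mono:
  "r \<le> s \<Longrightarrow> A \<in> sets borel \<Longrightarrow> upper_growth r A \<le> upper_growth s A"
  unfolding upper_growth_def by (intro Limsup_mono always_eventually allI log_mass_mono)

lemma lower_growth_mono:
  "r \<le> s \<Longrightarrow> A \<in> sets borel \<Longrightarrow> lower_growth r A \<le> lower_growth s A"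
  unfolding lower_growth_def by (intro Liminf_mono always_eventually allI log_mass_mono)

text \<open>Lower semicontinuity of \<open>I + \<psi>\<close>: the inequality \<open>I x + \<psi> x \<le> t\<close> says that for every real
  number \<open>q\<close> either \<open>I x \<le> q\<close> or \<open>\<psi> x \<le> t - q\<close>, and each of these alternatives is closed.\<close>

lemma closed_tilted_level: "closed {x. I x + ereal (\<psi> x) \<le> ereal t}"
proof -
  have "{x. I x + ereal (\<psi> x) \<le> ereal t} = (\<Inter>q. {x. I x \<le> ereal q} \<union> {x. \<psi> x \<le> t - q})"
  proof (intro set_eqI iffI)
    fix x assume "x \<in> {x. I x + ereal (\<psi> x) \<le> ereal t}"
    then show "x \<in> (\<Inter>q. {x. I x \<le> ereal q} \<union> {x. \<psi> x \<le> t - q})"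
      by (cases "I x") (use I_nonneg[of x] in auto)
  next
    fix x assume *: "x \<in> (\<Inter>q. {x. I x \<le> ereal q} \<union> {x. \<psi> x \<le> t - q})"
    have "I x \<le> ereal (t - \<psi> x)"
    proof (rule ereal_le_epsilon2)
      fix e :: real assume "0 < e"
      with * have "I x \<le> ereal (t - \<psi> x + e)"
        by (auto dest!: spec[of _ "t - \<psi> x + e"])
      then show "I x \<le> ereal (t - \<psi> x) + ereal e" by simp
    qed
    then show "x \<in> {x. I x + ereal (\<psi> x) \<le> ereal t}"
      by (cases "I x") auto
  qed
  also have "closed \<dots>"
    by (intro closed_INT ballI closed_Un compact_imp_closed compact_level
        closed_Collect_le \<psi>_continuous continuous_on_const)
  finally show ?thesis .
qed

lemma compact_tilted_level: "compact {x. I x + ereal (\<psi> x) \<le> ereal t}"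
proof -
  obtain B where B: "\<And>x. \<bar>\<psi> x\<bar> \<le> B" using \<psi>_bounded by (auto simp: bounded_iff)
  have "{x. I x + ereal (\<psi> x) \<le> ereal t}
      = {x. I x \<le> ereal (t + B)} \<inter> {x. I x + ereal (\<psi> x) \<le> ereal t}"
  proof (safe)
    fix x assume "I x + ereal (\<psi> x) \<le> ereal t"
    with B[of x] show "I x \<le> ereal (t + B)" by (cases "I x") auto
  qed
  then show ?thesis
    using compact_Int_closed[OF compact_level closed_tilted_level] by metis
qed

text \<open>A strict lower bound on the fiber survives, non-strictly, on a neighbourhood
  \<open>{x. d x \<le> r}\<close>: by compactness of the level sets, \<open>d\<close> attains a minimum on the part of \<open>F\<close> where
  \<open>I + \<psi> \<le> t\<close>, and this minimum is positive because that part misses the fiber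
  \<open>{x. d x = 0}\<close>.\<close>

lemma fiber_gap:
  assumes "closed F" and F: "\<And>x. x \<in> F \<Longrightarrow> d x = 0 \<Longrightarrow> ereal t < I x + ereal (\<psi> x)"
  obtains r where "0 < r" "\<And>x. x \<in> F \<Longrightarrow> d x \<le> r \<Longrightarrow> ereal t \<le> I x + ereal (\<psi> x)"
proof -
  let ?S = "F \<inter> {x. I x + ereal (\<psi> x) \<le> ereal t}"
  have "compact ?S"
    using \<open>closed F\<close> compact_tilted_level by (intro closed_Int_compact)
  show thesis
  proof (cases "?S = {}")
    case True
    then show thesis by (intro that[of 1]) auto
  next
    case False
    from continuous_attains_inf[OF \<open>compact ?S\<close> False continuous_on_subset[OF d_continuous]]
    obtain z where z: "z \<in> ?S" "\<And>y. y \<in> ?S \<Longrightarrow> d z \<le> d y" by auto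
    have "d z \<noteq> 0" using z(1) F[of z] by auto
    then have "0 < d z" using d_nonneg[of z] by simp
    show thesis
    proof (rule that)
      show "0 < d z / 2" using \<open>0 < d z\<close> by simp
      fix x assume "x \<in> F" "d x \<le> d z / 2"
      then have "x \<notin> ?S" using z(2)[of x] \<open>0 < d z\<close> by auto
      with \<open>x \<in> F\<close> show "ereal t \<le> I x + ereal (\<psi> x)" by auto
    qed
  qed
qed

lemma INF_upper_growth_le:
  assumes "closed F" "\<And>x. x \<in> F \<Longrightarrow> d x = 0 \<Longrightarrow> ereal t < I x + ereal (\<psi> x)"
  shows "(INF r\<in>{0<..}. upper_growth r F) \<le> - ereal t"
proof -
  obtain r where r: "0 < r" "\<And>x. x \<in> F \<Longrightarrow> d x \<le> r \<Longrightarrow> ereal t \<le> I x + ereal (\<psi> x)"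
    using fiber_gap[OF assms] by blast
  then show ?thesis
    by (intro INF_lower2[of "r / 2"] upper_growth_le[OF \<open>closed F\<close>, of _ r]) auto
qed

text \<open>The exponential decay rate of the normalizing constant.\<close>

definition min_rate :: real where
  "min_rate = real_of_ereal (INF x\<in>{x. d x = 0}. I x + ereal (\<psi> x))"

lemma tilted_rate_lower_bound:
  obtains B :: real where "\<And>x. ereal (- B) \<le> I x + ereal (\<psi> x)"
proof -
  obtain B where B: "\<And>x. \<bar>\<psi> x\<bar> \<le> B" using \<psi>_bounded by (auto simp: bounded_iff)
  show thesis
  proof (rule that)
    fix x show "ereal (- B) \<le> I x + ereal (\<psi> x)"
      using B[of x] I_nonneg[of x] by (cases "I x") (auto simp: abs_le_iff)
  qed
qed

lemma INF_eq_min_rate: "(INF x\<in>{x. d x = 0}. I x + ereal (\<psi> x)) = ereal min_rate"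
proof -
  obtain B where "\<And>x. ereal (- B) \<le> I x + ereal (\<psi> x)"
    using tilted_rate_lower_bound by blast
  then have "ereal (- B) \<le> (INF x\<in>{x. d x = 0}. I x + ereal (\<psi> x))"
    by (intro INF_greatest)
  moreover obtain z where "d z = 0" "I z < \<infinity>" using fiber_finite by blast
  then have "(INF x\<in>{x. d x = 0}. I x + ereal (\<psi> x)) < \<infinity>"
    by (intro INF_lower2[THEN le_less_trans, of z "{x. d x = 0}" _ "I z + ereal (\<psi> z)"]) auto
  ultimately show ?thesis
    unfolding min_rate_def by (intro ereal_real'[symmetric]) auto
qed

lemma min_rate_le: "d x = 0 \<Longrightarrow> ereal min_rate \<le> I x + ereal (\<psi> x)"
  unfolding INF_eq_min_rate[symmetric] by (intro INF_lower) simp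

lemma lower_growth_UNIV_ge:
  assumes "0 < r"
  shows "- ereal min_rate \<le> lower_growth r UNIV"
proof -
  have "- lower_growth r UNIV \<le> (INF x\<in>{x. d x = 0}. I x + ereal (\<psi> x))"
    using assms lower_growth_ge[of UNIV _ r]
    by (intro INF_greatest) (auto simp: ereal_uminus_le_reorder)
  then show ?thesis
    unfolding INF_eq_min_rate by (simp only: ereal_uminus_le_reorder)
qed

lemma lower_le_upper_growth: "lower_growth r A \<le> upper_growth r A"
  unfolding lower_growth_def upper_growth_def by (intro Liminf_le_Limsup) simp

lemma upper_growth_UNIV_tendsto:
  "((\<lambda>r. upper_growth r UNIV) \<longlongrightarrow> - ereal min_rate) (at_right 0)"
proof -
  have "(INF r\<in>{0<..}. upper_growth r UNIV) = - ereal min_rate"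
  proof (rule antisym)
    show "(INF r\<in>{0<..}. upper_growth r UNIV) \<le> - ereal min_rate"
    proof (rule ereal_le_epsilon2)
      fix e :: real assume "0 < e"
      have "(INF r\<in>{0<..}. upper_growth r UNIV) \<le> - ereal (min_rate - e)"
      proof (rule INF_upper_growth_le)
        fix x assume "d x = 0"
        from min_rate_le[OF this] \<open>0 < e\<close> show "ereal (min_rate - e) < I x + ereal (\<psi> x)"
          by (cases "I x") auto
      qed simp
      then show "(INF r\<in>{0<..}. upper_growth r UNIV) \<le> - ereal min_rate + ereal e" by simp
    qed
    show "- ereal min_rate \<le> (INF r\<in>{0<..}. upper_growth r UNIV)"
      by (intro INF_greatest order_trans[OF lower_growth_UNIV_ge lower_le_upper_growth]) simp
  qed
  then show ?thesis
    using mono_tendsto_at_right_INF[of "\<lambda>r. upper_growth r UNIV"] upper_growth_mono by simp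
qed

lemma growth_UNIV_finite:
  assumes "0 < r"
  shows "\<bar>upper_growth r UNIV\<bar> \<noteq> \<infinity>" "\<bar>lower_growth r UNIV\<bar> \<noteq> \<infinity>"
proof -
  obtain B where "\<And>x. ereal (- B) \<le> I x + ereal (\<psi> x)"
    using tilted_rate_lower_bound by blast
  then have "upper_growth r UNIV \<le> - ereal (- B)"
    by (intro upper_growth_le[where r' = "r + 1"]) auto
  with lower_growth_UNIV_ge[OF assms] lower_le_upper_growth[of r UNIV]
  show "\<bar>upper_growth r UNIV\<bar> \<noteq> \<infinity>" "\<bar>lower_growth r UNIV\<bar> \<noteq> \<infinity>"
    by (cases "upper_growth r UNIV"; cases "lower_growth r UNIV"; simp)+
qed

lemma eventually_mass_pos:
  assumes "0 < r"
  shows "\<forall>\<^sub>F n in sequentially. 0 < mass n r UNIV"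
proof -
  obtain x where x: "d x = 0" "I x < \<infinity>" using fiber_finite by blast
  then obtain t where "I x + ereal (\<psi> x) < ereal t"
    using ereal_dense2[of "I x + ereal (\<psi> x)" \<infinity>] by auto
  then have "\<forall>\<^sub>F n in sequentially. exp (- a n * t) \<le> mass n r UNIV"
    using x assms by (intro mass_lower[of UNIV x]) auto
  then show ?thesis by eventually_elim (rule less_le_trans[OF exp_gt_zero])
qed

section \<open>The conditioned and tilted large deviation principle\<close>

definition log_ratio :: "nat \<Rightarrow> real \<Rightarrow> 'x set \<Rightarrow> ereal" where
  "log_ratio n r A = scaled_log (a n) (mass n r A / mass n r UNIV)"

lemma log_ratio_eq:
  assumes "0 < r"
  shows "\<forall>\<^sub>F n in sequentially. log_ratio n r A = log_mass n r A + - log_mass n r UNIV"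
    and "\<forall>\<^sub>F n in sequentially. log_mass n r A = log_ratio n r A + log_mass n r UNIV"
proof -
  show *: "\<forall>\<^sub>F n in sequentially. log_ratio n r A = log_mass n r A + - log_mass n r UNIV"
    using eventually_mass_pos[OF assms]
    by eventually_elim
      (simp add: log_ratio_def log_mass_def scaled_log_divide a_pos mass_nonneg minus_ereal_def)
  show "\<forall>\<^sub>F n in sequentially. log_mass n r A = log_ratio n r A + log_mass n r UNIV"
    using * eventually_mass_pos[OF assms]
  proof eventually_elim
    case (elim n)
    have "log_mass n r UNIV = ereal (ln (mass n r UNIV) / a n)"
      using elim(2) by (simp add: log_mass_def ln_prob_def)
    with elim(1) show ?case by (cases "log_mass n r A") auto
  qed
qed

text \<open>Neither the numerator nor the denominator of \<open>mass n r A / mass n r UNIV\<close> need have a limit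
  in \<open>n\<close>, and the quotient is not monotone in \<open>r\<close>.  It is therefore enclosed between two
  expressions, both built from the monotone \<open>upper_growth r A\<close>, that differ only in their
  treatment of the denominator and merge as \<open>r\<close> tends to \<open>0\<close>.\<close>

lemma limsup_log_ratio_bounds:
  assumes "0 < r"
  shows "upper_growth r A - upper_growth r UNIV \<le> limsup (\<lambda>n. log_ratio n r A)"
    and "limsup (\<lambda>n. log_ratio n r A) \<le> upper_growth r A + ereal min_rate"
proof -
  have "limsup (\<lambda>n. log_ratio n r A) = limsup (\<lambda>n. log_mass n r A + - log_mass n r UNIV)"
    using log_ratio_eq(1)[OF assms] by (rule Limsup_eq)
  also have "\<dots> \<le> upper_growth r A + limsup (\<lambda>n. - log_mass n r UNIV)"
    unfolding upper_growth_def by (rule ereal_limsup_add_mono)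
  also have "limsup (\<lambda>n. - log_mass n r UNIV) = - lower_growth r UNIV"
    unfolding lower_growth_def by (rule ereal_Limsup_uminus)
  also have "upper_growth r A + - lower_growth r UNIV \<le> upper_growth r A + ereal min_rate"
    using lower_growth_UNIV_ge[OF assms] by (intro add_left_mono) (simp add: ereal_uminus_le_reorder)
  finally show "limsup (\<lambda>n. log_ratio n r A) \<le> upper_growth r A + ereal min_rate" .
  have "upper_growth r A = limsup (\<lambda>n. log_ratio n r A + log_mass n r UNIV)"
    unfolding upper_growth_def using log_ratio_eq(2)[OF assms] by (rule Limsup_eq)
  also have "\<dots> \<le> limsup (\<lambda>n. log_ratio n r A) + upper_growth r UNIV"
    unfolding upper_growth_def by (rule ereal_limsup_add_mono)
  finally show "upper_growth r A - upper_growth r UNIV \<le> limsup (\<lambda>n. log_ratio n r A)"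
    using growth_UNIV_finite(1)[OF assms] by (simp add: ereal_minus_le)
qed

lemma liminf_log_ratio_bounds:
  assumes "0 < r"
  shows "lower_growth r A - upper_growth r UNIV \<le> liminf (\<lambda>n. log_ratio n r A)"
    and "liminf (\<lambda>n. log_ratio n r A) \<le> lower_growth r A + ereal min_rate"
proof -
  have uminus: "liminf (\<lambda>n. - log_mass n r UNIV) = - upper_growth r UNIV"
    unfolding upper_growth_def by (rule ereal_Liminf_uminus)
  have "lower_growth r A + - upper_growth r UNIV
      \<le> liminf (\<lambda>n. log_mass n r A + - log_mass n r UNIV)"
    unfolding uminus[symmetric] lower_growth_def
    using growth_UNIV_finite(1)[OF assms] uminus by (intro ereal_liminf_add_mono) auto
  also have "\<dots> = liminf (\<lambda>n. log_ratio n r A)"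
    by (rule Liminf_eq[OF log_ratio_eq(1)[OF assms], symmetric])
  finally show "lower_growth r A - upper_growth r UNIV \<le> liminf (\<lambda>n. log_ratio n r A)"
    by (simp add: minus_ereal_def)
  have "liminf (\<lambda>n. log_ratio n r A) + lower_growth r UNIV
      \<le> liminf (\<lambda>n. log_ratio n r A + log_mass n r UNIV)"
    unfolding lower_growth_def using growth_UNIV_finite(2)[OF assms]
    by (intro ereal_liminf_add_mono) (auto simp: lower_growth_def)
  also have "\<dots> = lower_growth r A"
    unfolding lower_growth_def by (rule Liminf_eq[OF log_ratio_eq(2)[OF assms], symmetric])
  finally have "liminf (\<lambda>n. log_ratio n r A) \<le> lower_growth r A - lower_growth r UNIV"
    using growth_UNIV_finite(2)[OF assms] by (simp add: ereal_le_minus)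
  also have "\<dots> \<le> lower_growth r A + ereal min_rate"
    unfolding minus_ereal_def
    using lower_growth_UNIV_ge[OF assms] by (intro add_left_mono) (simp add: ereal_uminus_le_reorder)
  finally show "liminf (\<lambda>n. log_ratio n r A) \<le> lower_growth r A + ereal min_rate" .
qed

text \<open>Closes the sandwich, in a form that serves the upper growth for closed sets and the lower
  growth for open sets alike.\<close>

lemma ratio_growth_tendsto:
  fixes f g :: "real \<Rightarrow> ereal"
  assumes "\<And>r s. 0 < r \<Longrightarrow> r \<le> s \<Longrightarrow> g r \<le> g s"
    and "\<And>r. 0 < r \<Longrightarrow> g r - upper_growth r UNIV \<le> f r"
    and "\<And>r. 0 < r \<Longrightarrow> f r \<le> g r + ereal min_rate"
  shows "(f \<longlongrightarrow> (INF r\<in>{0<..}. g r) + ereal min_rate) (at_right 0)"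
proof (rule tendsto_sandwich)
  have g: "(g \<longlongrightarrow> (INF r\<in>{0<..}. g r)) (at_right 0)"
    using assms(1) by (rule mono_tendsto_at_right_INF)
  show "\<forall>\<^sub>F r in at_right 0. g r + - upper_growth r UNIV \<le> f r"
    using assms(2) by (auto simp: eventually_at_right_field minus_ereal_def intro!: exI[of _ 1])
  show "\<forall>\<^sub>F r in at_right 0. f r \<le> g r + ereal min_rate"
    using assms(3) by (auto simp: eventually_at_right_field intro!: exI[of _ 1])
  have "((\<lambda>r. - upper_growth r UNIV) \<longlongrightarrow> ereal min_rate) (at_right 0)"
    using tendsto_uminus_ereal[OF upper_growth_UNIV_tendsto] by simp
  then show "((\<lambda>r. g r + - upper_growth r UNIV) \<longlongrightarrow> (INF r\<in>{0<..}. g r) + ereal min_rate) (at_right 0)"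
    by (intro tendsto_add_ereal_general1 g) auto
  show "((\<lambda>r. g r + ereal min_rate) \<longlongrightarrow> (INF r\<in>{0<..}. g r) + ereal min_rate) (at_right 0)"
    by (intro tendsto_add_ereal_general1 g tendsto_const) auto
qed

definition rate :: "'x \<Rightarrow> ereal" where
  "rate x = rate_of I ({x} \<inter> {x. d x = 0}) + ereal (\<psi> x) - (INF y\<in>{y. d y = 0}. I y + ereal (\<psi> y))"

lemma rate_eq: "rate x = (if d x = 0 then I x + ereal (\<psi> x) - ereal min_rate else \<infinity>)"
  unfolding rate_def INF_eq_min_rate by (auto simp: rate_of_def top_ereal_def)

lemma rate_function_rate: "rate_function rate"
  unfolding rate_function_def
proof (intro conjI allI impI)
  fix x show "0 \<le> rate x"
    using min_rate_le[of x] by (cases "I x") (auto simp: rate_eq)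
next
  fix M :: real
  have "{x. rate x \<le> ereal M} = {x. d x = 0} \<inter> {x. I x + ereal (\<psi> x) \<le> ereal (M + min_rate)}"
  proof (rule set_eqI)
    fix x show "x \<in> {x. rate x \<le> ereal M} \<longleftrightarrow>
        x \<in> {x. d x = 0} \<inter> {x. I x + ereal (\<psi> x) \<le> ereal (M + min_rate)}"
      by (cases "I x") (auto simp: rate_eq)
  qed
  moreover have "closed {x. d x = 0}"
    by (intro closed_Collect_eq d_continuous continuous_on_const)
  ultimately show "compact {x. rate x \<le> ereal M}"
    using compact_tilted_level by (simp add: closed_Int_compact)
qed

lemma measure_normalized_weight:
  assumes "0 < mass n r UNIV" "A \<in> sets borel"
  shows "measure (normalized (P n) (weight n r)) {\<omega> \<in> space (P n). Y n \<omega> \<in> A} = mass n r A / mass n r UNIV"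
  using assms
  by (subst measure_normalized)
    (auto simp: mass_UNIV integrable_weight weight_nonneg mass_def[of n r A])

text \<open>After normalization the double-limit principle follows from the estimates on masses: the
  numerator is governed by \<open>I + \<psi>\<close> on the fiber, and the denominator subtracts its minimum.
  The measures \<open>Q n r\<close> are only required to agree with the normalized ones for large \<open>n\<close>,
  because for small \<open>n\<close> the conditioning event may be null.\<close>

theorem LDP_double_conditioned_tilted:
  assumes Q: "\<And>r. 0 < r \<Longrightarrow> r < 1 \<Longrightarrow>
      \<forall>\<^sub>F n in sequentially. Q n r = normalized (P n) (weight n r)"
  shows "LDP_double a Q Y rate"
proof -
  have eq: "\<forall>\<^sub>F n in sequentially. scaled_log (a n) (measure (Q n r) {\<omega> \<in> space (Q n r). Y n \<omega> \<in> A})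
      = log_ratio n r A" if "0 < r" "r < 1" "A \<in> sets borel" for r A
    using Q[OF that(1,2)] eventually_mass_pos[OF that(1)]
    by eventually_elim (use that(3) in \<open>simp add: log_ratio_def measure_normalized_weight\<close>)
  have unit: "\<forall>\<^sub>F r in at_right (0::real). 0 < r \<and> r < 1"
    by (auto simp: eventually_at_right_field intro!: exI[of _ 1])
  have limsup_eq: "\<forall>\<^sub>F r in at_right 0. limsup (\<lambda>n. log_ratio n r A) =
      limsup (\<lambda>n. scaled_log (a n) (measure (Q n r) {\<omega> \<in> space (Q n r). Y n \<omega> \<in> A}))"
    if "A \<in> sets borel" for A
    using unit by eventually_elim (rule Limsup_eq[symmetric], use eq that in auto)
  have liminf_eq: "\<forall>\<^sub>F r in at_right 0. liminf (\<lambda>n. log_ratio n r A) =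
      liminf (\<lambda>n. scaled_log (a n) (measure (Q n r) {\<omega> \<in> space (Q n r). Y n \<omega> \<in> A}))"
    if "A \<in> sets borel" for A
    using unit by eventually_elim (rule Liminf_eq[symmetric], use eq that in auto)
  show ?thesis
    unfolding LDP_double_def
  proof (intro conjI ballI allI impI)
    fix r :: real assume "r \<in> {0<..<1}"
    then have "0 < r" "r < 1" by auto
    from Q[OF this] eventually_mass_pos[OF \<open>0 < r\<close>]
    show "\<forall>\<^sub>F n in sequentially. prob_space (Q n r)"
      by eventually_elim
        (auto intro!: prob_space_normalized simp: integrable_weight weight_nonneg mass_UNIV)
  next
    show "rate_function rate" by (rule rate_function_rate)
  next
    fix F :: "'x set" assume "closed F"
    let ?L = "INF r\<in>{0<..}. upper_growth r F"
    have "((\<lambda>r. limsup (\<lambda>n. log_ratio n r F)) \<longlongrightarrow> ?L + ereal min_rate) (at_right 0)"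
      using \<open>closed F\<close> limsup_log_ratio_bounds
      by (intro ratio_growth_tendsto upper_growth_mono) auto
    then have "((\<lambda>r. limsup (\<lambda>n. scaled_log (a n) (measure (Q n r) {\<omega> \<in> space (Q n r). Y n \<omega> \<in> F})))
        \<longlongrightarrow> ?L + ereal min_rate) (at_right 0)"
      by (rule tendsto_cong[THEN iffD1, rotated]) (use \<open>closed F\<close> in \<open>intro limsup_eq borel_closed\<close>)
    \<comment> \<open>Every real \<open>q\<close> above \<open>- rate_of rate F\<close> bounds the limit: then \<open>rate > - q\<close> on \<open>F\<close>,
        which on the fiber means \<open>I + \<psi> > min_rate - q\<close>.\<close>
    moreover have "?L + ereal min_rate \<le> - rate_of rate F"
    proof (rule dense_le)
      fix y assume "y < ?L + ereal min_rate"
      then obtain q where q: "y < ereal q" "ereal q < ?L + ereal min_rate"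
        using ereal_dense2 by blast
      show "y \<le> - rate_of rate F"
      proof (rule ccontr)
        assume "\<not> y \<le> - rate_of rate F"
        with q have "- rate_of rate F < ereal q" by order
        then have *: "ereal (- q) < rate_of rate F"
          using ereal_minus_less_minus[of "rate_of rate F" "ereal (- q)"] by simp
        have "?L \<le> - ereal (min_rate - q)"
        proof (rule INF_upper_growth_le[OF \<open>closed F\<close>])
          fix x assume x: "x \<in> F" "d x = 0"
          have "rate_of rate F \<le> rate x"
            unfolding rate_of_def using x by (intro INF_lower)
          with * have "ereal (- q) < rate x" by order
          with x show "ereal (min_rate - q) < I x + ereal (\<psi> x)"
            by (cases "I x") (auto simp: rate_eq)
        qed
        then have "?L + ereal min_rate \<le> ereal q"
          by (cases ?L) auto
        with q show False by order
      qed
    qed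
    ultimately show "\<exists>L. ((\<lambda>r. limsup (\<lambda>n. scaled_log (a n)
        (measure (Q n r) {\<omega> \<in> space (Q n r). Y n \<omega> \<in> F}))) \<longlongrightarrow> L) (at_right 0)
        \<and> L \<le> - rate_of rate F" by blast
  next
    fix G :: "'x set" assume "open G"
    let ?L = "INF r\<in>{0<..}. lower_growth r G"
    have "((\<lambda>r. liminf (\<lambda>n. log_ratio n r G)) \<longlongrightarrow> ?L + ereal min_rate) (at_right 0)"
      using \<open>open G\<close> liminf_log_ratio_bounds
      by (intro ratio_growth_tendsto lower_growth_mono) auto
    then have "((\<lambda>r. liminf (\<lambda>n. scaled_log (a n) (measure (Q n r) {\<omega> \<in> space (Q n r). Y n \<omega> \<in> G})))
        \<longlongrightarrow> ?L + ereal min_rate) (at_right 0)"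
      by (rule tendsto_cong[THEN iffD1, rotated]) (use \<open>open G\<close> in \<open>intro liminf_eq borel_open\<close>)
    moreover have "- (?L + ereal min_rate) \<le> rate_of rate G"
      unfolding rate_of_def
    proof (rule INF_greatest)
      fix x assume "x \<in> G"
      show "- (?L + ereal min_rate) \<le> rate x"
      proof (cases "d x = 0")
        case True
        have "- (I x + ereal (\<psi> x)) \<le> ?L"
          using \<open>open G\<close> \<open>x \<in> G\<close> True by (intro INF_greatest lower_growth_ge) auto
        then show ?thesis
          using True I_nonneg[of x] by (cases "I x"; cases ?L) (auto simp: rate_eq)
      qed (simp add: rate_eq)
    qed
    then have "- rate_of rate G \<le> ?L + ereal min_rate"
      by (simp only: ereal_uminus_le_reorder)
    ultimately show "\<exists>L. ((\<lambda>r. liminf (\<lambda>n. scaled_log (a n)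
        (measure (Q n r) {\<omega> \<in> space (Q n r). Y n \<omega> \<in> G}))) \<longlongrightarrow> L) (at_right 0)
        \<and> - rate_of rate G \<le> L" by blast
  qed
qed

section \<open>Tilting and conditioning in either order\<close>

definition tilt :: "nat \<Rightarrow> 'w \<Rightarrow> real" where
  "tilt n \<omega> = exp (- a n * \<phi> n \<omega>)"

definition condition :: "nat \<Rightarrow> real \<Rightarrow> 'w set" where
  "condition n r = {\<omega> \<in> space (P n). \<delta> n \<omega> \<le> r}"

lemma weight_eq: "weight n r = (\<lambda>\<omega>. indicator (condition n r) \<omega> * tilt n \<omega>)"
  by (simp add: fun_eq_iff weight_def tilt_def condition_def)

lemma tilt_measurable [measurable]: "tilt n \<in> borel_measurable (P n)"
  unfolding tilt_def by measurable

lemma condition_measurable [measurable]: "condition n r \<in> sets (P n)"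
  unfolding condition_def by measurable

text \<open>A positive mass guarantees that the conditioning is by an event of positive probability, without
  which \<open>uniform_measure\<close> is not a probability measure.\<close>

lemma condition_pos:
  assumes "0 < mass n r UNIV"
  shows "0 < measure (P n) (condition n r)"
proof (rule ccontr)
  interpret prob_space "P n" by (rule prob_P)
  assume "\<not> ?thesis"
  then have "measure (P n) (condition n r) = 0" by (simp add: zero_less_measure_iff)
  then have "AE \<omega> in P n. \<omega> \<notin> condition n r"
    by (intro AE_not_in) (auto simp: null_sets_def emeasure_eq_measure)
  then have "AE \<omega> in P n. weight n r \<omega> = 0"
    by eventually_elim (simp add: weight_eq)
  then have "mass n r UNIV = 0"
    unfolding mass_UNIV by (simp add: integral_eq_zero_AE)
  with assms show False by simp
qed

lemma integrable_tilt: "integrable (P n) (tilt n)"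
  and integral_tilt_pos: "0 < (\<integral>\<omega>. tilt n \<omega> \<partial>P n)"
proof -
  interpret prob_space "P n" by (rule prob_P)
  obtain b where b: "\<And>\<omega>. \<omega> \<in> space (P n) \<Longrightarrow> \<bar>\<phi> n \<omega>\<bar> \<le> b"
    using \<phi>_bounded[of n] by (auto simp: bounded_iff)
  have bounds: "exp (- (a n * b)) \<le> tilt n \<omega>" "tilt n \<omega> \<le> exp (a n * b)" if "\<omega> \<in> space (P n)" for \<omega>
  proof -
    have "\<bar>a n * \<phi> n \<omega>\<bar> \<le> a n * b"
      using b[OF that] a_pos[of n] by (simp add: abs_mult)
    then show "exp (- (a n * b)) \<le> tilt n \<omega>" "tilt n \<omega> \<le> exp (a n * b)"
      by (auto simp: tilt_def abs_le_iff)
  qed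
  show *: "integrable (P n) (tilt n)"
    using bounds by (intro integrable_const_bound[where B = "exp (a n * b)"] AE_I2) (auto simp: tilt_def)
  have "0 < exp (- (a n * b))" by simp
  also have "\<dots> = (\<integral>\<omega>. exp (- (a n * b)) \<partial>P n)" by (simp add: prob_space)
  also have "\<dots> \<le> (\<integral>\<omega>. tilt n \<omega> \<partial>P n)"
    using * bounds by (intro integral_mono) auto
  finally show "0 < (\<integral>\<omega>. tilt n \<omega> \<partial>P n)" .
qed

lemma prob_space_tilted: "prob_space (normalized (P n) (tilt n))"
  by (intro prob_space_normalized integrable_tilt integral_tilt_pos) (simp add: tilt_def)

lemma condition_then_tilt:
  assumes "0 < mass n r UNIV"
  shows "normalized (uniform_measure (P n) (condition n r)) (tilt n) = normalized (P n) (weight n r)"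
proof -
  interpret prob_space "P n" by (rule prob_P)
  have "(\<integral>\<omega>. indicator (condition n r) \<omega> \<partial>P n) = measure (P n) (condition n r)"
    using sets.sets_into_space[OF condition_measurable] by (simp add: Int_absorb2)
  with condition_pos[OF assms] show ?thesis
    unfolding weight_eq
    by (subst uniform_measure_eq_normalized[OF prob_P condition_measurable], simp)
      (intro normalized_normalized, auto simp: tilt_def)
qed

lemma tilt_then_condition:
  assumes "0 < mass n r UNIV"
  shows "uniform_measure (normalized (P n) (tilt n)) (condition n r) = normalized (P n) (weight n r)"
proof -
  have "measure (normalized (P n) (tilt n)) (condition n r)
      = mass n r UNIV / (\<integral>\<omega>. tilt n \<omega> \<partial>P n)"
    unfolding mass_UNIV weight_eq
    by (intro measure_normalized integrable_tilt integral_tilt_pos) (auto simp: tilt_def)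
  then have "0 < measure (normalized (P n) (tilt n)) (condition n r)"
    using assms integral_tilt_pos by simp
  then have "uniform_measure (normalized (P n) (tilt n)) (condition n r)
      = normalized (normalized (P n) (tilt n)) (indicator (condition n r))"
    by (intro uniform_measure_eq_normalized prob_space_tilted) auto
  also have "\<dots> = normalized (P n) (\<lambda>\<omega>. tilt n \<omega> * indicator (condition n r) \<omega>)"
    by (intro normalized_normalized integral_tilt_pos) (auto simp: tilt_def)
  also have "\<dots> = normalized (P n) (weight n r)"
    by (simp add: weight_eq mult.commute)
  finally show ?thesis .
qed

lemma tilt_eq_weight:
  assumes "\<And>\<omega>. \<delta> n \<omega> = 0" "0 < r"
  shows "normalized (P n) (tilt n) = normalized (P n) (weight n r)"
  using assms by (intro normalized_cong) (auto simp: weight_eq condition_def)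

end

section \<open>Vector-valued constraints\<close>

text \<open>The supremum norm of the difference between \<open>(G\<^sub>1, \<dots>, G\<^sub>k)\<close> and \<open>v\<close>.  It condenses the
  conditioning on the cube \<open>{v}\<^sup>(\<^sup>r\<^sup>)\<close> to the scalar condition \<open>deviation k G v \<le> r\<close>.  The
  recursion starts at \<open>0\<close>, so for \<open>k = 0\<close> the condition holds for every \<open>r \<ge> 0\<close>.\<close>

primrec deviation :: "nat \<Rightarrow> (nat \<Rightarrow> 'a \<Rightarrow> real) \<Rightarrow> (nat \<Rightarrow> real) \<Rightarrow> 'a \<Rightarrow> real" where
  "deviation 0 G v x = 0"
| "deviation (Suc k) G v x = max (deviation k G v x) \<bar>G (Suc k) x - v (Suc k)\<bar>"

lemma deviation_nonneg: "0 \<le> deviation k G v x"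
  by (induction k) (auto simp: max_def)

lemma deviation_le_iff:
  "0 \<le> r \<Longrightarrow> deviation k G v x \<le> r \<longleftrightarrow> (\<forall>i\<in>{1..k}. \<bar>G i x - v i\<bar> \<le> r)"
  by (induction k) (auto simp: atLeastAtMostSuc_conv)

lemma deviation_zero_set: "{x. deviation k G v x = 0} = fiber k G v"
proof -
  have "deviation k G v x = 0 \<longleftrightarrow> deviation k G v x \<le> 0" for x
    using deviation_nonneg[of k G v x] by auto
  then show ?thesis by (simp add: deviation_le_iff fiber_def)
qed

lemma deviation_measurable:
  "(\<And>i. i \<in> {1..k} \<Longrightarrow> G i \<in> borel_measurable M) \<Longrightarrow> deviation k G v \<in> borel_measurable M"
proof (induction k)
  case (Suc k)
  then have "deviation k G v \<in> borel_measurable M" "G (Suc k) \<in> borel_measurable M" by auto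
  moreover have "deviation (Suc k) G v = (\<lambda>x. max (deviation k G v x) \<bar>G (Suc k) x - v (Suc k)\<bar>)"
    by (simp add: fun_eq_iff)
  ultimately show ?case by simp
next
  case 0
  have "deviation 0 G v = (\<lambda>x. 0)" by (simp add: fun_eq_iff)
  then show ?case by simp
qed

lemma deviation_continuous:
  "(\<And>i. i \<in> {1..k} \<Longrightarrow> continuous_on S (G i)) \<Longrightarrow> continuous_on S (deviation k G v)"
  by (induction k) (auto intro!: continuous_intros)

lemma deviation_perturb:
  assumes "\<And>i. i \<in> {1..k} \<Longrightarrow> \<bar>G i x - G' i y\<bar> \<le> \<epsilon>" "0 \<le> \<epsilon>"
  shows "\<bar>deviation k G v x - deviation k G' v y\<bar> \<le> \<epsilon>"
  using assms(1)
proof (induction k)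
  case (Suc k)
  then have "\<bar>deviation k G v x - deviation k G' v y\<bar> \<le> \<epsilon>" "\<bar>G (Suc k) x - G' (Suc k) y\<bar> \<le> \<epsilon>" by auto
  then show ?case by (auto simp: max_def abs_le_iff abs_if split: if_splits)
qed (use assms(2) in simp)

section \<open>Canonical and microcanonical ensembles\<close>

lemma inner_prod_scale: "inner_prod k (\<lambda>i. c * b i) w = c * inner_prod k b w"
  by (simp add: inner_prod_def sum_distrib_left mult.assoc)

lemma inner_prod_measurable:
  "(\<And>i. i \<in> {1..k} \<Longrightarrow> G i \<in> borel_measurable M) \<Longrightarrow>
     (\<lambda>\<omega>. inner_prod k b (\<lambda>i. G i \<omega>)) \<in> borel_measurable M"
  unfolding inner_prod_def by (intro borel_measurable_sum borel_measurable_times) auto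

lemma inner_prod_continuous:
  "(\<And>i. i \<in> {1..k} \<Longrightarrow> continuous_on S (G i)) \<Longrightarrow> continuous_on S (\<lambda>x. inner_prod k b (\<lambda>i. G i x))"
  unfolding inner_prod_def by (intro continuous_intros) auto

lemma inner_prod_bounded:
  assumes "\<And>i. i \<in> {1..k} \<Longrightarrow> bounded (G i ` S)"
  shows "bounded ((\<lambda>x. inner_prod k b (\<lambda>i. G i x)) ` S)"
proof -
  have "\<exists>C. \<forall>i\<in>{1..k}. \<forall>x\<in>S. \<bar>G i x\<bar> \<le> C i"
    using assms by (intro bchoice) (auto simp: bounded_iff)
  then obtain C where C: "\<And>i x. i \<in> {1..k} \<Longrightarrow> x \<in> S \<Longrightarrow> \<bar>G i x\<bar> \<le> C i" by blast
  have "norm (inner_prod k b (\<lambda>i. G i x)) \<le> (\<Sum>i\<in>{1..k}. \<bar>b i\<bar> * C i)" if "x \<in> S" for x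
    unfolding inner_prod_def
    using C that by (intro sum_norm_le) (auto simp: abs_mult intro!: mult_left_mono)
  then show ?thesis by (auto simp: bounded_iff)
qed

lemma inner_prod_perturb:
  assumes "\<And>i. i \<in> {1..k} \<Longrightarrow> \<bar>v i - w i\<bar> \<le> \<epsilon>"
  shows "\<bar>inner_prod k b v - inner_prod k b w\<bar> \<le> (\<Sum>i\<in>{1..k}. \<bar>b i\<bar>) * \<epsilon>"
proof -
  have "inner_prod k b v - inner_prod k b w = (\<Sum>i\<in>{1..k}. b i * (v i - w i))"
    by (simp add: inner_prod_def sum_subtractf algebra_simps)
  also have "\<bar>\<dots>\<bar> \<le> (\<Sum>i\<in>{1..k}. \<bar>b i\<bar> * \<epsilon>)"
    using assms by (intro order_trans[OF sum_abs] sum_mono) (auto simp: abs_mult intro!: mult_left_mono)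
  finally show ?thesis by (simp add: sum_distrib_right)
qed

lemma canonical_eq_normalized:
  "canonical k G (\<lambda>i. c * b i) Q = normalized Q (\<lambda>\<omega>. exp (- c * inner_prod k b (\<lambda>i. G i \<omega>)))"
  by (simp add: canonical_def normalized_def inner_prod_scale)

lemma microcanonical_eq_deviation:
  assumes "0 \<le> r"
  shows "microcanonical k G v r Q = uniform_measure Q {\<omega> \<in> space Q. deviation k G v \<omega> \<le> r}"
proof -
  have "G i \<omega> \<in> {v i - r..v i + r} \<longleftrightarrow> \<bar>G i \<omega> - v i\<bar> \<le> r" for i \<omega>
    by (auto simp: abs_le_iff)
  then show ?thesis using assms by (simp add: microcanonical_def deviation_le_iff)
qed

lemma second_block_0 [simp]: "second_block 0 G = G"
  by (simp add: second_block_def)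

lemma sum_blocks:
  fixes f :: "nat \<Rightarrow> 'b::comm_monoid_add"
  assumes "\<tau> \<le> \<sigma>"
  shows "(\<Sum>i\<in>{1..\<sigma>}. f i) = (\<Sum>i\<in>{1..\<tau>}. f i) + (\<Sum>j\<in>{1..\<sigma> - \<tau>}. f (\<tau> + j))"
proof -
  have "(\<Sum>i\<in>{1..\<sigma>}. f i) = (\<Sum>i\<in>{1..\<tau>}. f i) + (\<Sum>i\<in>{\<tau> + 1..\<sigma>}. f i)"
    using assms sum.ub_add_nat[of 1 \<tau> f "\<sigma> - \<tau>"] by simp
  also have "(\<Sum>i\<in>{\<tau> + 1..\<sigma>}. f i) = (\<Sum>j\<in>{1..\<sigma> - \<tau>}. f (\<tau> + j))"
    by (rule sum.reindex_bij_witness[of _ "\<lambda>j. \<tau> + j" "\<lambda>i. i - \<tau>"]) auto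
  finally show ?thesis .
qed

lemma inner_prod_concat_vec:
  assumes "\<tau> \<le> \<sigma>"
  shows "inner_prod \<sigma> (concat_vec \<tau> b c) (\<lambda>i. G i x) =
    inner_prod \<tau> b (\<lambda>i. G i x) + inner_prod (\<sigma> - \<tau>) c (\<lambda>i. second_block \<tau> G i x)"
  unfolding inner_prod_def sum_blocks[OF assms]
  by (intro arg_cong2[of _ _ _ _ "(+)"] sum.cong) (auto simp: concat_vec_def second_block_def)

lemma fiber_concat_vec:
  assumes "\<tau> \<le> \<sigma>"
  shows "fiber \<sigma> G (concat_vec \<tau> u v) = fiber \<tau> G u \<inter> fiber (\<sigma> - \<tau>) (second_block \<tau> G) v"
proof -
  have "(\<forall>i\<in>{1..\<sigma>}. G i x = concat_vec \<tau> u v i) \<longleftrightarrow>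
    (\<forall>i\<in>{1..\<tau>}. G i x = u i) \<and> (\<forall>j\<in>{1..\<sigma> - \<tau>}. G (\<tau> + j) x = v j)" (is "?L \<longleftrightarrow> ?R") for x
  proof
    assume L: ?L
    show ?R
    proof (intro conjI ballI)
      fix i assume "i \<in> {1..\<tau>}"
      then show "G i x = u i" using L assms by (auto simp: concat_vec_def dest!: bspec[of _ _ i])
    next
      fix j assume "j \<in> {1..\<sigma> - \<tau>}"
      then show "G (\<tau> + j) x = v j" using L by (auto simp: concat_vec_def dest!: bspec[of _ _ "\<tau> + j"])
    qed
  next
    assume R: ?R
    show ?L
    proof
      fix i assume i: "i \<in> {1..\<sigma>}"
      show "G i x = concat_vec \<tau> u v i"
      proof (cases "i \<le> \<tau>")
        case True
        then show ?thesis using R i by (simp add: concat_vec_def)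
      next
        case False
        then have "i - \<tau> \<in> {1..\<sigma> - \<tau>}" using i by auto
        with R have "G (\<tau> + (i - \<tau>)) x = v (i - \<tau>)" by blast
        with False show ?thesis by (simp add: concat_vec_def)
      qed
    qed
  qed
  then show ?thesis by (auto simp: fiber_def second_block_def)
qed

lemma concat_vec_scale: "concat_vec \<tau> (\<lambda>i. c * u i) (\<lambda>i. c * v i) = (\<lambda>i. c * concat_vec \<tau> u v i)"
  by (simp add: concat_vec_def fun_eq_iff)

lemma ex_finite_if_INF_finite:
  fixes f :: "'b \<Rightarrow> ereal"
  assumes "\<bar>INF x\<in>A. f x\<bar> \<noteq> \<infinity>"
  shows "\<exists>x\<in>A. f x < \<infinity>"
proof -
  have "(INF x\<in>A. f x) < \<infinity>" using assms by (cases "INF x\<in>A. f x") auto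
  then show ?thesis unfolding INF_less_iff .
qed

section \<open>Ensembles of Hamiltonians\<close>

locale hamiltonian_sequence = ldp_sequence P a Y I
  for P :: "nat \<Rightarrow> 'w measure" and a :: "nat \<Rightarrow> real"
    and Y :: "nat \<Rightarrow> 'w \<Rightarrow> 'x::t2_space" and I :: "'x \<Rightarrow> ereal" +
  fixes \<sigma> :: nat and H :: "nat \<Rightarrow> nat \<Rightarrow> 'w \<Rightarrow> real" and Ht :: "nat \<Rightarrow> 'x \<Rightarrow> real"
  assumes H_measurable: "\<And>n i. i \<in> {1..\<sigma>} \<Longrightarrow> H n i \<in> borel_measurable (P n)"
    and H_bounded: "\<And>n i. i \<in> {1..\<sigma>} \<Longrightarrow> bounded (H n i ` space (P n))"
    and Ht_continuous: "\<And>i. i \<in> {1..\<sigma>} \<Longrightarrow> continuous_on UNIV (Ht i)"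
    and Ht_bounded: "\<And>i. i \<in> {1..\<sigma>} \<Longrightarrow> bounded (range (Ht i))"
    and H_approx: "\<And>i. i \<in> {1..\<sigma>} \<Longrightarrow> approximates (\<lambda>n. H n i) (Ht i)"
begin

lemma H_approx_uniform:
  assumes "0 < \<epsilon>"
  shows "\<forall>\<^sub>F n in sequentially. \<forall>i\<in>{1..\<sigma>}. \<forall>\<omega>\<in>space (P n). \<bar>H n i \<omega> - Ht i (Y n \<omega>)\<bar> \<le> \<epsilon>"
  using assms H_approx by (intro eventually_ball_finite) (auto simp: approximates_def)

text \<open>The tilt uses the first \<open>k\<close> components and the constraint the components \<open>p + 1, \<dots>, p + l\<close>.
  Taking \<open>l = 0\<close> gives a purely canonical ensemble, \<open>k = 0\<close> with \<open>p = 0\<close> and \<open>l = \<sigma>\<close> the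
  microcanonical one, and \<open>p = k\<close> the mixed ones.\<close>

lemma tilted_conditioned_ensemble:
  assumes "k \<le> \<sigma>" "p + l \<le> \<sigma>" "\<exists>x\<in>fiber l (second_block p Ht) v. I x < \<infinity>"
  shows "tilted_conditioned P a Y I
    (\<lambda>n \<omega>. inner_prod k b (\<lambda>i. H n i \<omega>)) (\<lambda>x. inner_prod k b (\<lambda>i. Ht i x))
    (\<lambda>n. deviation l (second_block p (H n)) v) (deviation l (second_block p Ht) v)"
proof
  fix n
  show "(\<lambda>\<omega>. inner_prod k b (\<lambda>i. H n i \<omega>)) \<in> borel_measurable (P n)"
    using assms(1) by (intro inner_prod_measurable H_measurable) auto
  show "bounded ((\<lambda>\<omega>. inner_prod k b (\<lambda>i. H n i \<omega>)) ` space (P n))"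
    using assms(1) by (intro inner_prod_bounded H_bounded) auto
  show "deviation l (second_block p (H n)) v \<in> borel_measurable (P n)"
    using assms(2) by (intro deviation_measurable) (auto simp: second_block_def intro!: H_measurable)
next
  show "continuous_on UNIV (\<lambda>x. inner_prod k b (\<lambda>i. Ht i x))"
    using assms(1) by (intro inner_prod_continuous Ht_continuous) auto
  show "bounded (range (\<lambda>x. inner_prod k b (\<lambda>i. Ht i x)))"
    using assms(1) by (intro inner_prod_bounded Ht_bounded) auto
  show "continuous_on UNIV (deviation l (second_block p Ht) v)"
    using assms(2) by (intro deviation_continuous) (auto simp: second_block_def intro!: Ht_continuous)
  show "0 \<le> deviation l (second_block p Ht) v x" for x
    by (rule deviation_nonneg)
  show "\<exists>x. deviation l (second_block p Ht) v x = 0 \<and> I x < \<infinity>"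
    using assms(3) unfolding deviation_zero_set[symmetric] by blast
  show "approximates (\<lambda>n \<omega>. inner_prod k b (\<lambda>i. H n i \<omega>)) (\<lambda>x. inner_prod k b (\<lambda>i. Ht i x))"
    unfolding approximates_def
  proof (intro allI impI)
    fix \<epsilon> :: real assume "0 < \<epsilon>"
    define B where "B = (\<Sum>i\<in>{1..k}. \<bar>b i\<bar>)"
    have "0 \<le> B" by (simp add: B_def sum_nonneg)
    have "0 < \<epsilon> / (B + 1)" using \<open>0 < \<epsilon>\<close> \<open>0 \<le> B\<close> by simp
    from H_approx_uniform[OF this]
    show "\<forall>\<^sub>F n in sequentially. \<forall>\<omega>\<in>space (P n).
      \<bar>inner_prod k b (\<lambda>i. H n i \<omega>) - inner_prod k b (\<lambda>i. Ht i (Y n \<omega>))\<bar> \<le> \<epsilon>"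
    proof eventually_elim
      case (elim n)
      show ?case
      proof
        fix \<omega> assume "\<omega> \<in> space (P n)"
        then have "\<bar>inner_prod k b (\<lambda>i. H n i \<omega>) - inner_prod k b (\<lambda>i. Ht i (Y n \<omega>))\<bar>
            \<le> B * (\<epsilon> / (B + 1))"
          unfolding B_def using elim assms(1) by (intro inner_prod_perturb) (auto simp: B_def)
        also have "\<dots> \<le> \<epsilon>" using \<open>0 < \<epsilon>\<close> \<open>0 \<le> B\<close> by (simp add: field_simps)
        finally show "\<bar>inner_prod k b (\<lambda>i. H n i \<omega>) - inner_prod k b (\<lambda>i. Ht i (Y n \<omega>))\<bar> \<le> \<epsilon>" .
      qed
    qed
  qed
  show "approximates (\<lambda>n. deviation l (second_block p (H n)) v) (deviation l (second_block p Ht) v)"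
    unfolding approximates_def
  proof (intro allI impI)
    fix \<epsilon> :: real assume "0 < \<epsilon>"
    from H_approx_uniform[OF this]
    show "\<forall>\<^sub>F n in sequentially. \<forall>\<omega>\<in>space (P n).
      \<bar>deviation l (second_block p (H n)) v \<omega> - deviation l (second_block p Ht) v (Y n \<omega>)\<bar> \<le> \<epsilon>"
    proof eventually_elim
      case (elim n)
      then show ?case
        using assms(2) \<open>0 < \<epsilon>\<close> by (intro ballI deviation_perturb) (auto simp: second_block_def)
    qed
  qed
qed

theorem LDP_canonical:
  "LDP a (\<lambda>n. canonical \<sigma> (H n) (\<lambda>i. a n * b i) (P n)) Y
    (\<lambda>x. I x + ereal (inner_prod \<sigma> b (\<lambda>i. Ht i x))
      - (INF y. I y + ereal (inner_prod \<sigma> b (\<lambda>i. Ht i y))))"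
proof -
  obtain x where "I x < \<infinity>" using ex_finite_rate by blast
  then have finite: "\<exists>x\<in>fiber 0 (second_block 0 Ht) (\<lambda>_. 0). I x < \<infinity>"
    by (auto simp: fiber_def)
  interpret T: tilted_conditioned P a Y I
    "\<lambda>n \<omega>. inner_prod \<sigma> b (\<lambda>i. H n i \<omega>)" "\<lambda>x. inner_prod \<sigma> b (\<lambda>i. Ht i x)"
    "\<lambda>n. deviation 0 (second_block 0 (H n)) (\<lambda>_. 0)" "deviation 0 (second_block 0 Ht) (\<lambda>_. 0)"
    by (rule tilted_conditioned_ensemble[OF _ _ finite]) auto
  have can: "canonical \<sigma> (H n) (\<lambda>i. a n * b i) (P n) = normalized (P n) (T.tilt n)" for n
    by (simp add: canonical_eq_normalized T.tilt_def[abs_def])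
  have "LDP_double a (\<lambda>n r. canonical \<sigma> (H n) (\<lambda>i. a n * b i) (P n)) Y T.rate"
    by (intro T.LDP_double_conditioned_tilted always_eventually allI)
      (simp add: can T.tilt_eq_weight)
  then have "LDP a (\<lambda>n. canonical \<sigma> (H n) (\<lambda>i. a n * b i) (P n)) Y T.rate"
    by (rule LDP_if_LDP_double_const) (simp add: can T.prob_space_tilted)
  then show ?thesis
    unfolding T.rate_def[abs_def] by (simp add: rate_of_def)
qed

text \<open>Once the constraint has positive probability, both mixed ensembles coincide with the same
  normalized weight and hence share the rate function.\<close>

theorem LDP_mixed:
  fixes p l k :: nat and v b :: "nat \<Rightarrow> real"
  defines "S \<equiv> fiber l (second_block p Ht) v"
  defines "K \<equiv> \<lambda>x. rate_of I ({x} \<inter> S) + ereal (inner_prod k b (\<lambda>i. Ht i x))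
    - (INF y\<in>S. I y + ereal (inner_prod k b (\<lambda>i. Ht i y)))"
  assumes dims: "k \<le> \<sigma>" "p + l \<le> \<sigma>" and finite: "\<exists>x\<in>S. I x < \<infinity>"
  shows LDP_canonical_microcanonical: "LDP_double a
      (\<lambda>n r. canonical k (H n) (\<lambda>i. a n * b i) (microcanonical l (second_block p (H n)) v r (P n))) Y K"
    and LDP_microcanonical_canonical: "LDP_double a
      (\<lambda>n r. microcanonical l (second_block p (H n)) v r (canonical k (H n) (\<lambda>i. a n * b i) (P n))) Y K"
proof -
  interpret T: tilted_conditioned P a Y I
    "\<lambda>n \<omega>. inner_prod k b (\<lambda>i. H n i \<omega>)" "\<lambda>x. inner_prod k b (\<lambda>i. Ht i x)"
    "\<lambda>n. deviation l (second_block p (H n)) v" "deviation l (second_block p Ht) v"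
    using tilted_conditioned_ensemble[OF dims finite[unfolded S_def]] .
  have K: "K = T.rate"
    unfolding K_def S_def T.rate_def[abs_def] deviation_zero_set ..
  have can: "canonical k (H n) (\<lambda>i. a n * b i) Q = normalized Q (T.tilt n)" for n Q
    by (simp add: canonical_eq_normalized T.tilt_def[abs_def])
  have micro: "microcanonical l (second_block p (H n)) v r Q = uniform_measure Q (T.condition n r)"
    if "0 < r" "space Q = space (P n)" for n r Q
    using that by (simp add: microcanonical_eq_deviation T.condition_def)
  show "LDP_double a
      (\<lambda>n r. canonical k (H n) (\<lambda>i. a n * b i) (microcanonical l (second_block p (H n)) v r (P n))) Y K"
    unfolding K
  proof (rule T.LDP_double_conditioned_tilted)
    fix r :: real assume "0 < r"
    from T.eventually_mass_pos[OF this]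
    show "\<forall>\<^sub>F n in sequentially. canonical k (H n) (\<lambda>i. a n * b i)
        (microcanonical l (second_block p (H n)) v r (P n)) = normalized (P n) (T.weight n r)"
      by eventually_elim (simp add: can micro \<open>0 < r\<close> T.condition_then_tilt)
  qed
  show "LDP_double a
      (\<lambda>n r. microcanonical l (second_block p (H n)) v r (canonical k (H n) (\<lambda>i. a n * b i) (P n))) Y K"
    unfolding K
  proof (rule T.LDP_double_conditioned_tilted)
    fix r :: real assume "0 < r"
    from T.eventually_mass_pos[OF this]
    show "\<forall>\<^sub>F n in sequentially. microcanonical l (second_block p (H n)) v r
        (canonical k (H n) (\<lambda>i. a n * b i) (P n)) = normalized (P n) (T.weight n r)"
      by eventually_elim (simp add: can micro \<open>0 < r\<close> T.tilt_then_condition)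
  qed
qed

text \<open>The special case of a mixed ensemble with trivial tilt: the canonical ensemble of zero
  Hamiltonians is the original measure.\<close>

theorem LDP_microcanonical:
  assumes finite: "\<exists>x\<in>fiber \<sigma> Ht v. I x < \<infinity>"
  shows "LDP_double a (\<lambda>n r. microcanonical \<sigma> (H n) v r (P n)) Y
    (\<lambda>x. rate_of I ({x} \<inter> fiber \<sigma> Ht v) - (INF y\<in>fiber \<sigma> Ht v. I y))"
proof -
  have finite': "\<exists>x\<in>fiber \<sigma> (second_block 0 Ht) v. I x < \<infinity>" using finite by simp
  have "LDP_double a
      (\<lambda>n r. microcanonical \<sigma> (second_block 0 (H n)) v r (canonical 0 (H n) (\<lambda>i. a n * 0) (P n))) Y
      (\<lambda>x. rate_of I ({x} \<inter> fiber \<sigma> (second_block 0 Ht) v) + ereal (inner_prod 0 (\<lambda>_. 0) (\<lambda>i. Ht i x))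
    - (INF y\<in>fiber \<sigma> (second_block 0 Ht) v. I y + ereal (inner_prod 0 (\<lambda>_. 0) (\<lambda>i. Ht i y))))"
    by (rule LDP_microcanonical_canonical[OF _ _ finite']) auto
  moreover have "canonical 0 (H n) (\<lambda>i. a n * 0) (P n) = P n" for n
    using prob_space.prob_space[OF prob_P[of n]]
    by (simp add: canonical_def inner_prod_def density_1)
  ultimately show ?thesis by (simp add: inner_prod_def flip: zero_ereal_def)
qed

end

theorem theorem5p1p1:
  fixes P :: "nat \<Rightarrow> 'w measure"
    and \<sigma> \<tau> :: nat
    and H :: "nat \<Rightarrow> nat \<Rightarrow> 'w \<Rightarrow> real"
    and a :: "nat \<Rightarrow> real"
    and Y :: "nat \<Rightarrow> 'w \<Rightarrow> 'x::polish_space"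
    and Ht :: "nat \<Rightarrow> 'x \<Rightarrow> real"
    and I :: "'x \<Rightarrow> ereal"
    and \<beta>1 \<beta>2 :: "nat \<Rightarrow> real"
  assumes prob_P: "\<And>n. prob_space (P n)"
    and sigma: "2 \<le> \<sigma>"
    and tau: "1 \<le> \<tau>" "\<tau> \<le> \<sigma>"
    and H_measurable: "\<And>n i. i \<in> {1..\<sigma>} \<Longrightarrow> H n i \<in> borel_measurable (P n)"
    and H_bounded: "\<And>n i. i \<in> {1..\<sigma>} \<Longrightarrow> bounded (H n i ` space (P n))"
    and a_pos: "\<And>n. 0 < a n"
    and a_lim: "filterlim a at_top sequentially"
    and Y_measurable: "\<And>n. Y n \<in> measurable (P n) borel"
    and Ht_continuous: "\<And>i. i \<in> {1..\<sigma>} \<Longrightarrow> continuous_on UNIV (Ht i)"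
    and Ht_bounded: "\<And>i. i \<in> {1..\<sigma>} \<Longrightarrow> bounded (range (Ht i))"
    and H_approx: "\<And>i. i \<in> {1..\<sigma>} \<Longrightarrow>
          (\<lambda>n. SUP \<omega>\<in>space (P n). \<bar>H n i \<omega> - Ht i (Y n \<omega>)\<bar>) \<longlonglongrightarrow> 0"
    and LDP_P: "LDP a P Y I"
  shows
    "LDP a
       (\<lambda>n. canonical \<sigma> (H n) (concat_vec \<tau> (\<lambda>i. a n * \<beta>1 i) (\<lambda>i. a n * \<beta>2 i)) (P n)) Y
       (\<lambda>x. I x + ereal (inner_prod \<tau> \<beta>1 (\<lambda>i. Ht i x))
                + ereal (inner_prod (\<sigma> - \<tau>) \<beta>2 (\<lambda>i. second_block \<tau> Ht i x))
            - (INF y. I y + ereal (inner_prod \<tau> \<beta>1 (\<lambda>i. Ht i y))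
                          + ereal (inner_prod (\<sigma> - \<tau>) \<beta>2 (\<lambda>i. second_block \<tau> Ht i y)))) \<and>
     (\<forall>u2. \<bar>J_two \<sigma> \<tau> I Ht u2\<bar> \<noteq> \<infinity> \<longrightarrow>
       (let K = (\<lambda>x. rate_of I ({x} \<inter> fiber (\<sigma> - \<tau>) (second_block \<tau> Ht) u2)
                       + ereal (inner_prod \<tau> \<beta>1 (\<lambda>i. Ht i x))
                     - (INF y\<in>fiber (\<sigma> - \<tau>) (second_block \<tau> Ht) u2.
                          I y + ereal (inner_prod \<tau> \<beta>1 (\<lambda>i. Ht i y))))
        in LDP_double a
             (\<lambda>n r. canonical \<tau> (H n) (\<lambda>i. a n * \<beta>1 i)
                      (microcanonical (\<sigma> - \<tau>) (second_block \<tau> (H n)) u2 r (P n))) Y K \<and>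
           LDP_double a
             (\<lambda>n r. microcanonical (\<sigma> - \<tau>) (second_block \<tau> (H n)) u2 r
                      (canonical \<tau> (H n) (\<lambda>i. a n * \<beta>1 i) (P n))) Y K)) \<and>
     (\<forall>u1 u2. \<bar>J_joint \<sigma> \<tau> I Ht u1 u2\<bar> \<noteq> \<infinity> \<longrightarrow>
       LDP_double a
         (\<lambda>n r. microcanonical \<sigma> (H n) (concat_vec \<tau> u1 u2) r (P n)) Y
         (\<lambda>x. rate_of I ({x} \<inter> fiber \<tau> Ht u1 \<inter> fiber (\<sigma> - \<tau>) (second_block \<tau> Ht) u2)
              - J_joint \<sigma> \<tau> I Ht u1 u2))"
proof -
  interpret L: ldp_sequence P a Y I
    by (rule ldp_sequence.intro) (fact prob_P a_pos a_lim Y_measurable LDP_P)+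
  have "L.approximates (\<lambda>n. H n i) (Ht i)" if i: "i \<in> {1..\<sigma>}" for i
    unfolding L.approximates_def
  proof (intro allI impI)
    fix \<epsilon> :: real assume "0 < \<epsilon>"
    let ?D = "\<lambda>n \<omega>. \<bar>H n i \<omega> - Ht i (Y n \<omega>)\<bar>"
    \<comment> \<open>The supremum dominates the individual values only for a set that is bounded above.\<close>
    have bdd: "bdd_above (?D n ` space (P n))" for n
    proof -
      obtain B C where B: "\<And>\<omega>. \<omega> \<in> space (P n) \<Longrightarrow> \<bar>H n i \<omega>\<bar> \<le> B"
        and C: "\<And>x. \<bar>Ht i x\<bar> \<le> C"
        using H_bounded[OF i, of n] Ht_bounded[OF i] by (auto simp: bounded_iff)
      show ?thesis
      proof (rule bdd_aboveI2)
        fix \<omega> assume "\<omega> \<in> space (P n)"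
        with B[of \<omega>] C[of "Y n \<omega>"] show "?D n \<omega> \<le> B + C" by linarith
      qed
    qed
    have "\<forall>\<^sub>F n in sequentially. (SUP \<omega>\<in>space (P n). ?D n \<omega>) < \<epsilon>"
      using H_approx[OF i] \<open>0 < \<epsilon>\<close> by (rule order_tendstoD)
    then show "\<forall>\<^sub>F n in sequentially. \<forall>\<omega>\<in>space (P n). ?D n \<omega> \<le> \<epsilon>"
    proof eventually_elim
      case (elim n)
      then show ?case using cSUP_upper[OF _ bdd[of n]] by fastforce
    qed
  qed
  note approx = this
  interpret L: hamiltonian_sequence P a Y I \<sigma> H Ht
    by (intro hamiltonian_sequence.intro hamiltonian_sequence_axioms.intro L.ldp_sequence_axioms
        H_measurable H_bounded Ht_continuous Ht_bounded approx)
  show ?thesis (is "?A \<and> ?B \<and> ?C")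
  proof (intro conjI)
    show ?A
      using L.LDP_canonical[of "concat_vec \<tau> \<beta>1 \<beta>2"] tau(2)
      by (simp add: concat_vec_scale inner_prod_concat_vec add.assoc)
  next
    show ?B
      unfolding J_two_def Let_def
    proof (intro allI impI)
      fix u2 assume "\<bar>INF x\<in>fiber (\<sigma> - \<tau>) (second_block \<tau> Ht) u2. I x\<bar> \<noteq> \<infinity>"
      then have "\<exists>x\<in>fiber (\<sigma> - \<tau>) (second_block \<tau> Ht) u2. I x < \<infinity>"
        by (rule ex_finite_if_INF_finite)
      from L.LDP_mixed[OF _ _ this, of \<tau> \<beta>1] tau
      show "LDP_double a
             (\<lambda>n r. canonical \<tau> (H n) (\<lambda>i. a n * \<beta>1 i)
                      (microcanonical (\<sigma> - \<tau>) (second_block \<tau> (H n)) u2 r (P n))) Y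
             (\<lambda>x. rate_of I ({x} \<inter> fiber (\<sigma> - \<tau>) (second_block \<tau> Ht) u2)
                       + ereal (inner_prod \<tau> \<beta>1 (\<lambda>i. Ht i x))
                     - (INF y\<in>fiber (\<sigma> - \<tau>) (second_block \<tau> Ht) u2.
                          I y + ereal (inner_prod \<tau> \<beta>1 (\<lambda>i. Ht i y)))) \<and>
           LDP_double a
             (\<lambda>n r. microcanonical (\<sigma> - \<tau>) (second_block \<tau> (H n)) u2 r
                      (canonical \<tau> (H n) (\<lambda>i. a n * \<beta>1 i) (P n))) Y
             (\<lambda>x. rate_of I ({x} \<inter> fiber (\<sigma> - \<tau>) (second_block \<tau> Ht) u2)
                       + ereal (inner_prod \<tau> \<beta>1 (\<lambda>i. Ht i x))
                     - (INF y\<in>fiber (\<sigma> - \<tau>) (second_block \<tau> Ht) u2.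
                          I y + ereal (inner_prod \<tau> \<beta>1 (\<lambda>i. Ht i y))))"
        by simp
    qed
  next
    show ?C
      unfolding J_joint_def
    proof (intro allI impI)
      fix u1 u2
      let ?v = "concat_vec \<tau> u1 u2"
      assume "\<bar>INF x\<in>fiber \<tau> Ht u1 \<inter> fiber (\<sigma> - \<tau>) (second_block \<tau> Ht) u2. I x\<bar> \<noteq> \<infinity>"
      then have "\<exists>x\<in>fiber \<sigma> Ht ?v. I x < \<infinity>"
        unfolding fiber_concat_vec[OF tau(2)] by (rule ex_finite_if_INF_finite)
      from L.LDP_microcanonical[OF this]
      show "LDP_double a
         (\<lambda>n r. microcanonical \<sigma> (H n) ?v r (P n)) Y
         (\<lambda>x. rate_of I ({x} \<inter> fiber \<tau> Ht u1 \<inter> fiber (\<sigma> - \<tau>) (second_block \<tau> Ht) u2)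
              - (INF x\<in>fiber \<tau> Ht u1 \<inter> fiber (\<sigma> - \<tau>) (second_block \<tau> Ht) u2. I x))"
        by (simp add: fiber_concat_vec[OF tau(2)] Int_assoc)
    qed
  qed
qed

end
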